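(* Let $n>2k\ge 6$ and let $0=\gamma_0<\gamma_1<\dots<\gamma_m=\binom{n-4}{k-3}$ be $0$ together with all resistant numbers, in increasing order. Let $\mathcal F\subset\binom{[n]}{k}$ be intersecting with $\gamma_{l-1}<\gamma(\mathcal F)\le\gamma_l$ for some $l\in[m]$, and let $\gamma_l=\sum_{i=1}^{s_b}\binom{n-b_i}{n-k-i}$ be the $(n-k-1)$-cascade form of $\gamma_l$, with $T_{\gamma_l}=\{b_1,\dots,b_{s_b}\}$ and $S_{\gamma_l}=\{a_1<\dots<a_{s_a}\}$. Then $$|\mathcal F|\le \sum_{i=1}^{s_a}\binom{n-a_i}{n-k-i+1}+\gamma_l.$$ The right-hand side strictly decreases as $l$ increases. Moreover, the bound is sharp: for each $l\in[m]$ there exists an intersecting family in $\binom{[n]}{k}$ with diversity $\gamma_l$ attaining it.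
   Context: A family is intersecting if any two of its sets intersect; $\Delta(\mathcal F)$ is the maximal degree of an element and $\gamma(\mathcal F)=|\mathcal F|-\Delta(\mathcal F)$ is the diversity. Every positive integer $\gamma<\binom{n-1}{k-1}$ has a unique $(n-k-1)$-cascade form $\gamma=\binom{n-b_1}{n-k-1}+\binom{n-b_2}{n-k-2}+\dots+\binom{n-b_{s_b}}{n-k-s_b}$ with $1<b_1<b_2<\dots<b_{s_b}$ (the standard Kruskal–Katona cascade representation with top index $n-k-1$). Put $T_\gamma=\{b_1,\dots,b_{s_b}\}$ and $S_\gamma=T_\gamma\oplus\{2,\dots,b_{s_b}-1\}$ ($\oplus$ = symmetric difference), written $S_\gamma=\{a_1<\dots<a_{s_a}\}$ (so $a_{s_a}=b_{s_b}$). A nonnegative integer $\gamma$ is resistant if either $\gamma=\binom{n-4}{k-3}$, or (1) $s_a=|S_\gamma|\le k$ and $s_b=|T_\gamma|\le k-1$, and (2) $b_i>2i+2$ for each $i\in[s_b]$. No integer larger than $\binom{n-4}{k-3}$ is resistant. *)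

theory Defs
  imports Complex_Main
begin

definition k_subsets :: "nat \<Rightarrow> nat \<Rightarrow> nat set set" where
  "k_subsets n k = {A. A \<subseteq> {1..n} \<and> card A = k}"

definition intersecting :: "nat set set \<Rightarrow> bool" where
  "intersecting F \<longleftrightarrow> (\<forall>A\<in>F. \<forall>B\<in>F. A \<inter> B \<noteq> {})"

definition degree :: "nat set set \<Rightarrow> nat \<Rightarrow> nat" where
  "degree F x = card {A \<in> F. x \<in> A}"

definition max_degree :: "nat \<Rightarrow> nat set set \<Rightarrow> nat" where
  "max_degree n F = Max (degree F ` {1..n})"

definition diversity :: "nat \<Rightarrow> nat set set \<Rightarrow> nat" where
  "diversity n F = card F - max_degree n F"

text \<open>
  The list \<open>bs\<close> is \<open>[b\<^sub>1, ..., b\<^sub>s]\<close>, with \<open>b\<^sub>i\<close> stored at position \<open>i - 1\<close>.  The conditions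
  \<open>b\<^sub>i \<le> k + i\<close> (that is, \<open>n - b\<^sub>i \<ge> n - k - i\<close>) and \<open>s < n - k\<close> (that is, all lower indices
  are positive) are those of the standard cascade representation; without them vanishing
  summands, or summands with lower index 0, would destroy uniqueness.
\<close>

definition is_cascade :: "nat \<Rightarrow> nat \<Rightarrow> nat \<Rightarrow> nat list \<Rightarrow> bool" where
  "is_cascade n k g bs \<longleftrightarrow>
     bs \<noteq> [] \<and> length bs < n - k \<and> sorted_wrt (<) bs \<and> (\<forall>b\<in>set bs. 1 < b) \<and>
     (\<forall>i\<in>{1..length bs}. bs ! (i - 1) \<le> k + i) \<and>
     g = (\<Sum>i=1..length bs. (n - bs ! (i - 1)) choose (n - k - i))"

text \<open>
  Existence and uniqueness for \<open>0 < g < (n - 1 choose k - 1)\<close> are established in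
  \<open>is_cascade_ex1\<close> below.
\<close>

definition cascade :: "nat \<Rightarrow> nat \<Rightarrow> nat \<Rightarrow> nat list" where
  "cascade n k g = (THE bs. is_cascade n k g bs)"

definition T_set :: "nat \<Rightarrow> nat \<Rightarrow> nat \<Rightarrow> nat set" where
  "T_set n k g = set (cascade n k g)"

definition S_set :: "nat \<Rightarrow> nat \<Rightarrow> nat \<Rightarrow> nat set" where
  "S_set n k g = sym_diff (T_set n k g) {2..Max (T_set n k g) - 1}"

definition kth :: "nat set \<Rightarrow> nat \<Rightarrow> nat" where
  "kth A i = sorted_list_of_set A ! (i - 1)"

text \<open>
  The number 0 has no cascade form, hence the guard; it is adjoined separately
  to the set of resistant numbers wherever these are enumerated.
\<close>

definition resistant :: "nat \<Rightarrow> nat \<Rightarrow> nat \<Rightarrow> bool" where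
  "resistant n k g \<longleftrightarrow>
     g = (n - 4) choose (k - 3) \<or>
     (0 < g \<and> g < (n - 1) choose (k - 1) \<and>
      card (S_set n k g) \<le> k \<and> card (T_set n k g) \<le> k - 1 \<and>
      (\<forall>i\<in>{1..card (T_set n k g)}. 2 * i + 2 < kth (T_set n k g) i))"

definition size_bound :: "nat \<Rightarrow> nat \<Rightarrow> nat \<Rightarrow> nat" where
  "size_bound n k g =
     (\<Sum>i=1..card (S_set n k g). (n - kth (S_set n k g) i) choose (n - k - i + 1)) + g"

fun cascade_sum :: "nat \<Rightarrow> nat \<Rightarrow> nat list \<Rightarrow> nat" where
  "cascade_sum n r [] = 0"
| "cascade_sum n r (b # bs) = ((n - b) choose r) + cascade_sum n (r - 1) bs"

fun cascade_adm :: "nat \<Rightarrow> nat \<Rightarrow> nat \<Rightarrow> nat list \<Rightarrow> bool" where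
  "cascade_adm n p r [] = True"
| "cascade_adm n p r (b # bs) = (p < b \<and> 0 < r \<and> b + r \<le> n \<and> cascade_adm n b (r - 1) bs)"

lemma cascade_sum_less:
  "cascade_adm n p r bs \<Longrightarrow> p + r \<le> n \<Longrightarrow> cascade_sum n r bs < (n - p) choose r"
proof (induction bs arbitrary: p r)
  case Nil
  then show ?case by simp
next
  case (Cons b bs)
  then obtain q where q: "r = Suc q" by (cases r) auto
  have "cascade_sum n q bs < (n - b) choose q"
    using Cons q by simp
  then have "cascade_sum n r (b # bs) < Suc (n - b) choose r"
    using q by simp
  also have "\<dots> \<le> (n - p) choose r"
    using Cons.prems by (intro binomial_right_mono) auto
  finally show ?case .
qed

lemma cascade_sum_pos:
  "cascade_adm n p r bs \<Longrightarrow> bs \<noteq> [] \<Longrightarrow> 0 < cascade_sum n r bs"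
  by (cases bs) (auto simp: zero_less_binomial_iff)

lemma cascade_sum_inj:
  "cascade_adm n p r bs \<Longrightarrow> cascade_adm n p r cs \<Longrightarrow>
   cascade_sum n r bs = cascade_sum n r cs \<Longrightarrow> bs = cs"
proof (induction bs arbitrary: p r cs)
  case Nil
  then show ?case using cascade_sum_pos[of n p r cs] by (cases cs) auto
next
  case (Cons b bs)
  have "cs \<noteq> []"
    using Cons.prems cascade_sum_pos[of n p r "b # bs"] by auto
  then obtain c cs' where cs: "cs = c # cs'" by (cases cs) auto
  have less: "cascade_sum n r (x # xs) < cascade_sum n r (y # ys)"
    if "cascade_adm n p r (x # xs)" "cascade_adm n p r (y # ys)" "y < x" for x y xs ys
  proof -
    have "cascade_adm n y r (x # xs)" using that by simp
    then have "cascade_sum n r (x # xs) < (n - y) choose r"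
      using that by (intro cascade_sum_less) auto
    then show ?thesis by simp
  qed
  have "b = c"
    using less[of b bs c cs'] less[of c cs' b bs] Cons.prems cs by (metis less_irrefl linorder_neqE)
  then show ?case using Cons cs by auto
qed

lemma cascade_sum_surj:
  "p + r \<le> n \<Longrightarrow> g < (n - p) choose r \<Longrightarrow> \<exists>bs. cascade_adm n p r bs \<and> cascade_sum n r bs = g"
proof (induction r arbitrary: p g)
  case 0
  then show ?case by (intro exI[of _ "[]"]) simp
next
  case (Suc r)
  show ?case
  proof (cases "g = 0")
    case True
    then show ?thesis by (intro exI[of _ "[]"]) simp
  next
    case False
    define P where "P b \<longleftrightarrow> p < b \<and> b + Suc r \<le> n \<and> (n - b) choose Suc r \<le> g" for b
    have "p + Suc r \<noteq> n"
    proof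
      assume "p + Suc r = n"
      then have "n - p = Suc r" by simp
      then show False using Suc.prems False by simp
    qed
    then have "P (n - Suc r)" using Suc.prems False by (auto simp: P_def)
    define b where "b = (LEAST b. P b)"
    have b: "P b" unfolding b_def by (rule LeastI) fact
    have up: "g < (n - (b - 1)) choose Suc r"
    proof (cases "b - 1 = p")
      case True
      then show ?thesis using Suc.prems by simp
    next
      case False
      have "b - 1 < b" using b by (simp add: P_def)
      then have "\<not> P (b - 1)" unfolding b_def by (rule not_less_Least)
      then show ?thesis using b False by (auto simp: P_def)
    qed
    have "n - (b - 1) = Suc (n - b)" using b by (auto simp: P_def)
    then have "g - ((n - b) choose Suc r) < (n - b) choose r" using up b by (auto simp: P_def)
    then obtain bs where "cascade_adm n b r bs" "cascade_sum n r bs = g - ((n - b) choose Suc r)"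
      using Suc.IH[of b] b by (auto simp: P_def)
    then show ?thesis using b by (intro exI[of _ "b # bs"]) (auto simp: P_def)
  qed
qed

lemma cascade_sum_altdef:
  "cascade_sum n r bs = (\<Sum>i<length bs. (n - bs ! i) choose (r - i))"
  by (induction bs arbitrary: r) (simp_all add: sum.lessThan_Suc_shift del: sum.lessThan_Suc)

lemma cascade_adm_altdef:
  "cascade_adm n p r bs \<longleftrightarrow>
     sorted_wrt (<) bs \<and> (\<forall>b\<in>set bs. p < b) \<and> length bs \<le> r \<and>
     (\<forall>i<length bs. bs ! i + r \<le> n + i)"
proof (induction bs arbitrary: p r)
  case Nil
  then show ?case by simp
next
  case (Cons b bs)
  show ?case
    unfolding cascade_adm.simps Cons.IH length_Cons All_less_Suc2
    by (cases r) (auto intro: less_trans)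
qed

lemma is_cascade_iff:
  assumes "k < n"
  shows "is_cascade n k g bs \<longleftrightarrow>
    bs \<noteq> [] \<and> cascade_adm n 1 (n - k - 1) bs \<and> cascade_sum n (n - k - 1) bs = g"
proof -
  have *: "(\<forall>i\<in>{1..m}. Q i) \<longleftrightarrow> (\<forall>i<m. Q (Suc i))" for Q and m :: nat
    by (auto simp: Suc_le_eq) (metis Suc_le_D Suc_le_lessD le_refl less_eq_Suc_le)
  have **: "(\<Sum>i=1..m. f i) = (\<Sum>i<m. f (Suc i))" for f :: "nat \<Rightarrow> nat" and m
    by (simp add: sum.atLeast1_atMost_eq)
  show ?thesis
    unfolding is_cascade_def cascade_adm_altdef cascade_sum_altdef * **
    using assms by auto
qed

lemma is_cascade_ex1:
  assumes "2 * k < n" "0 < g" "g < (n - 1) choose (k - 1)"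
  shows "\<exists>!bs. is_cascade n k g bs"
proof -
  have kn: "k < n" using assms by simp
  have "k \<noteq> 0"
  proof
    assume "k = 0"
    then show False using assms by simp
  qed
  have "(n - 1) choose (k - 1) \<le> (n - 1) choose k"
    using assms by (intro binomial_mono) simp_all
  also have "\<dots> = (n - 1) choose (n - k - 1)"
    using binomial_symmetric[of k "n - 1"] kn by (simp add: diff_commute)
  finally have "g < (n - 1) choose (n - k - 1)" using assms by simp
  moreover have "1 + (n - k - 1) \<le> n" using kn by linarith
  ultimately obtain bs where bs: "cascade_adm n 1 (n - k - 1) bs" "cascade_sum n (n - k - 1) bs = g"
    using cascade_sum_surj[of 1 "n - k - 1" n g] by blast
  then have "bs \<noteq> []" using assms by auto
  with bs show ?thesis
    unfolding is_cascade_iff[OF kn] by (metis cascade_sum_inj)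
qed

end

theory Submission
  imports Defs
begin

text \<open>
  Split an intersecting family at an element \<open>x\<close> of maximal degree into the members avoiding \<open>x\<close>,
  whose number is the diversity \<open>\<gamma>\<close>, and those containing \<open>x\<close>.  The two parts are
  cross-intersecting, so the complements of the former cast an iterated shadow that the latter must
  avoid, and Kruskal--Katona bounds the size of the family by \<open>(n - 1 choose k - 1)\<close> plus the gain
  \<open>\<Sum>\<^sub>i (n - b\<^sub>i choose n - k - i) - (n - b\<^sub>i choose k - i)\<close> of the cascade of \<open>\<gamma>\<close>.  By Pascal's
  rule, the gain of a block of the cascade is the sum of the gains of its two halves, and its sign
  is determined by the position.  Hence the gain strictly decreases along resistant numbers, and
  for every other number there is a larger resistant one with at least the same gain.  Equality
  is attained by initial lexicographic segments.
\<close>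

section \<open>Gains of cascades\<close>

text \<open>Rows are unimodal and symmetric: a \<open>v\<close> beyond the middle is reflected to
  \<open>m - v\<close>, which is still at least \<open>u\<close>.\<close>

lemma binomial_le_of_sum_le:
  assumes "u \<le> v" "u + v \<le> m"
  shows "m choose u \<le> m choose v"
proof (cases "2 * v \<le> m")
  case True
  then show ?thesis using assms by (intro binomial_mono) auto
next
  case False
  have "m choose u \<le> m choose (m - v)"
    using assms False by (intro binomial_mono) auto
  also have "\<dots> = m choose v"
    using assms binomial_symmetric[of v m] by simp
  finally show ?thesis .
qed

lemma binomial_less_of_sum_less:
  assumes "u < v" "u + v < m"
  shows "m choose u < m choose v"
proof (cases "2 * v \<le> m")
  case True
  then show ?thesis using assms by (intro binomial_strict_mono) auto
next
  case False
  have "m choose u < m choose (m - v)"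
    using assms False by (intro binomial_strict_mono) auto
  also have "\<dots> = m choose v"
    using assms binomial_symmetric[of v m] by simp
  finally show ?thesis .
qed

text \<open>Negative lower indices yield 0, so that Pascal's rule holds for every integer; truncated
  subtraction would yield lower index 0 and hence the value 1.\<close>

definition int_binomial :: "nat \<Rightarrow> int \<Rightarrow> int" where
  "int_binomial m v = (if v < 0 then 0 else int (m choose nat v))"

lemma int_binomial_of_nat [simp]: "int_binomial m (int v) = int (m choose v)"
  by (simp add: int_binomial_def)

lemma int_binomial_Suc: "int_binomial (Suc m) v = int_binomial m v + int_binomial m (v - 1)"
proof -
  consider "v < 0" | "v = 0" | w where "v = int (Suc w)"
    by (metis linorder_neqE_linordered_idom not0_implies_Suc int_nat_eq nat_eq_iff2 zero_less_nat_eq less_irrefl zless_iff_Suc_zadd add_0)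
  then show ?thesis
    by cases (simp_all add: int_binomial_def nat_diff_distrib nat_add_distrib)
qed

text \<open>
  A position \<open>p\<close> and a top index \<open>r\<close> stand for the block of sets whose trace on \<open>{2..p}\<close> is
  prescribed.  Filling the block adds \<open>(n - p) choose r\<close> sets avoiding the element of maximal
  degree and removes \<open>(n - p) choose (r - c)\<close> sets containing it, where \<open>c = n - 2 * k\<close>.
\<close>

definition block_gain :: "nat \<Rightarrow> nat \<Rightarrow> nat \<Rightarrow> nat \<Rightarrow> int" where
  "block_gain n c p r = int ((n - p) choose r) - int_binomial (n - p) (int r - int c)"

fun cascade_gain :: "nat \<Rightarrow> nat \<Rightarrow> nat \<Rightarrow> nat list \<Rightarrow> int" where
  "cascade_gain n c r [] = 0"
| "cascade_gain n c r (b # bs) = block_gain n c b r + cascade_gain n c (r - 1) bs"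

text \<open>For \<open>r = n - k - i\<close> and \<open>c = n - 2 * k\<close> the inequality reads \<open>b > 2 * i + 2\<close>.\<close>

fun cascade_good :: "nat \<Rightarrow> nat \<Rightarrow> nat \<Rightarrow> nat list \<Rightarrow> bool" where
  "cascade_good n c r [] = True"
| "cascade_good n c r (b # bs) = (n + c + 2 < b + 2 * r \<and> cascade_good n c (r - 1) bs)"

section \<open>Splitting and sign of block gains\<close>

lemma block_gain_split:
  assumes "p < n" "0 < r"
  shows "block_gain n c p r = block_gain n c (Suc p) r + block_gain n c (Suc p) (r - 1)"
proof -
  obtain q where q: "r = Suc q" using assms by (cases r) auto
  have m: "n - p = Suc (n - Suc p)" using assms by simp
  have v: "int (Suc q) - int c - 1 = int q - int c" by simp
  show ?thesis
    unfolding block_gain_def q m int_binomial_Suc v by simp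
qed

text \<open>After reflecting \<open>r\<close> to \<open>n - p - r\<close>, the indices to compare
  are \<open>n - p - r\<close> and \<open>r - c\<close>. Their sum \<open>n - p - c\<close> is at
  most \<open>n - p\<close>, so their order decides the sign of the gain, and it is the order of
  \<open>n + c\<close> and \<open>p + 2 * r\<close>.\<close>

lemma block_gain_nonpos:
  assumes "p + r \<le> n" "n + c \<le> p + 2 * r"
  shows "block_gain n c p r \<le> 0"
proof -
  have c: "c \<le> r" using assms by linarith
  have "(n - p) choose r = (n - p) choose (n - p - r)"
    using assms by (intro binomial_symmetric) simp
  also have "\<dots> \<le> (n - p) choose (r - c)"
    using assms by (intro binomial_le_of_sum_le) auto
  finally show ?thesis
    using c unfolding block_gain_def by (simp flip: of_nat_diff)
qed

text \<open>For \<open>0 < c\<close> the two compared indices add up to less than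
  \<open>n - p\<close>, so they are not mirror images of each other and the comparison is
  strict.\<close>

lemma block_gain_neg:
  assumes "p + r \<le> n" "n + c < p + 2 * r" "0 < c"
  shows "block_gain n c p r < 0"
proof -
  have c: "c \<le> r" using assms by linarith
  have "(n - p) choose r = (n - p) choose (n - p - r)"
    using assms by (intro binomial_symmetric) simp
  also have "\<dots> < (n - p) choose (r - c)"
    using assms by (intro binomial_less_of_sum_less) auto
  finally show ?thesis
    using c unfolding block_gain_def by (simp flip: of_nat_diff)
qed

lemma block_gain_nonneg:
  assumes "p + r \<le> n" "p + 2 * r \<le> n + c"
  shows "0 \<le> block_gain n c p r"
proof (cases "c \<le> r")
  case True
  have "(n - p) choose (r - c) \<le> (n - p) choose (n - p - r)"
    using assms by (intro binomial_le_of_sum_le) auto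
  also have "\<dots> = (n - p) choose r"
    using assms by (intro binomial_symmetric[symmetric]) simp
  finally show ?thesis
    using True unfolding block_gain_def by (simp flip: of_nat_diff)
next
  case False
  then show ?thesis unfolding block_gain_def by (simp add: int_binomial_def)
qed

section \<open>Gains of cascades inside a block\<close>

lemma cascade_adm_mono: "cascade_adm n p r bs \<Longrightarrow> q \<le> p \<Longrightarrow> cascade_adm n q r bs"
  by (cases bs) auto

lemma cascade_adm_Suc: "cascade_adm n p r (b # bs) \<Longrightarrow> b \<noteq> Suc p \<Longrightarrow> cascade_adm n (Suc p) r (b # bs)"
  by auto

text \<open>A cascade fills the half with index \<open>r\<close> before the half with index
  \<open>r - 1\<close>. Either the second half has nonnegative gain, or both halves have nonpositive
  gain; in both cases stopping midway gains no more than stopping at the start or at the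
  end.\<close>

lemma cascade_gain_le_max:
  assumes "cascade_adm n p r bs" "p + r \<le> n"
  shows "cascade_gain n c r bs \<le> max 0 (block_gain n c p r)"
  using assms
proof (induction "n - p" arbitrary: p r bs)
  case 0
  then show ?case by (cases bs) auto
next
  case (Suc m)
  show ?case
  proof (cases bs)
    case Nil
    then show ?thesis by simp
  next
    case (Cons b bs')
    have p: "p < n" and r: "0 < r" and b: "p < b" "b + r \<le> n"
      and bs': "cascade_adm n b (r - 1) bs'"
      using Suc.prems Cons by auto
    note split = block_gain_split[OF p r, of c]
    have m: "m = n - Suc p" using Suc.hyps by simp
    have pr: "Suc p + (r - 1) \<le> n" "Suc p + r \<le> n" using b r by auto
    consider "b = Suc p" | "b \<noteq> Suc p" by blast
    then show ?thesis
    proof cases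
      case 1
      have IH: "cascade_gain n c (r - 1) bs' \<le> max 0 (block_gain n c (Suc p) (r - 1))"
        using Suc.hyps(1)[OF m] bs' 1 pr by auto
      show ?thesis
      proof (cases "Suc p + 2 * (r - 1) \<le> n + c")
        case True
        then have "0 \<le> block_gain n c (Suc p) (r - 1)"
          using pr by (intro block_gain_nonneg) auto
        then show ?thesis using IH Cons 1 split by auto
      next
        case False
        then have "block_gain n c (Suc p) (r - 1) \<le> 0" "block_gain n c (Suc p) r \<le> 0"
          using pr by (auto intro!: block_gain_nonpos)
        then show ?thesis using IH Cons 1 by auto
      qed
    next
      case 2
      have IH: "cascade_gain n c r bs \<le> max 0 (block_gain n c (Suc p) r)"
        using Suc.hyps(1)[OF m] Suc.prems Cons 2 pr cascade_adm_Suc by blast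
      show ?thesis
      proof (cases "Suc p + 2 * (r - 1) \<le> n + c")
        case True
        then have "0 \<le> block_gain n c (Suc p) (r - 1)"
          using pr by (intro block_gain_nonneg) auto
        then show ?thesis using IH split by auto
      next
        case False
        then have "block_gain n c (Suc p) r \<le> 0"
          using pr by (intro block_gain_nonpos) auto
        then show ?thesis using IH by auto
      qed
    qed
  qed
qed

lemma cascade_gain_good_nonpos:
  assumes "cascade_adm n p r bs" "cascade_good n c r bs" "0 < c"
  shows "cascade_gain n c r bs \<le> 0 \<and> (bs \<noteq> [] \<longrightarrow> cascade_gain n c r bs < 0)"
  using assms
proof (induction bs arbitrary: p r)
  case (Cons b bs)
  have "block_gain n c b r < 0"
    using Cons.prems by (intro block_gain_neg) auto
  then show ?case using Cons by fastforce
qed simp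

text \<open>Completing a good cascade to the whole block adds only halves of nonpositive gain and,
  where the cascade ends, a block of negative gain.\<close>

lemma block_gain_less_cascade_gain:
  assumes "cascade_adm n p r bs" "cascade_good n c r bs" "0 < c"
    and "p + r \<le> n" "n + c < p + 2 * r"
  shows "block_gain n c p r < cascade_gain n c r bs"
  using assms
proof (induction "n - p" arbitrary: p r bs)
  case 0
  then have "bs = []" by (cases bs) auto
  then show ?case using 0 by (auto intro!: block_gain_neg)
next
  case (Suc m)
  show ?case
  proof (cases bs)
    case Nil
    then show ?thesis using Suc.prems by (auto intro!: block_gain_neg)
  next
    case (Cons b bs')
    have p: "p < n" and r: "0 < r" and b: "p < b" "b + r \<le> n"
      and bs': "cascade_adm n b (r - 1) bs'"
      and good: "n + c + 2 < b + 2 * r" "cascade_good n c (r - 1) bs'"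
      using Suc.prems Cons by auto
    note split = block_gain_split[OF p r, of c]
    have m: "m = n - Suc p" using Suc.hyps by simp
    have pr: "Suc p + (r - 1) \<le> n" "Suc p + r \<le> n" using b r by auto
    show ?thesis
    proof (cases "b = Suc p")
      case True
      \<comment> \<open>Lowering \<open>r\<close> by one costs 2 in this inequality; the margin 2 in
        \<open>cascade_good\<close> pays for it.\<close>
      have "n + c < Suc p + 2 * (r - 1)" using good(1) True by auto
      then have "block_gain n c (Suc p) (r - 1) < cascade_gain n c (r - 1) bs'"
        using Suc.hyps(1)[OF m] bs' good True pr Suc.prems by auto
      then show ?thesis using Cons True split by simp
    next
      case False
      have "block_gain n c (Suc p) r < cascade_gain n c r bs"
        using Suc.hyps(1)[OF m, of r bs] Suc.prems Cons False pr cascade_adm_Suc by auto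
      moreover have "block_gain n c (Suc p) (r - 1) \<le> 0"
        using Suc.prems pr r by (intro block_gain_nonpos) auto
      ultimately show ?thesis using split by simp
    qed
  qed
qed

text \<open>At the first difference the larger cascade either merely continues, with negative gain,
  or has the smaller entry. In the second case it fills a block containing the rest of the other
  cascade, and its own remaining entries add no positive gain.\<close>

lemma cascade_gain_strict_antimono:
  assumes "cascade_adm n p r bs" "cascade_adm n p r cs"
    and "cascade_good n c r bs" "cascade_good n c r cs" "0 < c"
    and "cascade_sum n r bs < cascade_sum n r cs"
  shows "cascade_gain n c r cs < cascade_gain n c r bs"
  using assms
proof (induction bs arbitrary: p r cs)
  case Nil
  then show ?case using cascade_gain_good_nonpos[of n p r cs c] by (cases cs) auto
next
  case (Cons b bs)
  obtain d ds where cs: "cs = d # ds" using Cons.prems by (cases cs) auto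
  consider "d = b" | "d < b" | "b < d" by linarith
  then show ?case
  proof cases
    case 1
    then show ?thesis using Cons cs by fastforce
  next
    case 2
    have "cascade_adm n d r (b # bs)" using Cons.prems 2 by simp
    then have "block_gain n c d r < cascade_gain n c r (b # bs)"
      using Cons.prems cs by (intro block_gain_less_cascade_gain) auto
    moreover have "cascade_gain n c (r - 1) ds \<le> 0"
      using cascade_gain_good_nonpos[of n d "r - 1" ds c] Cons.prems cs by auto
    ultimately show ?thesis using cs by simp
  next
    case 3
    have "cascade_adm n b r (d # ds)" using Cons.prems 3 cs by simp
    then have "cascade_sum n r (d # ds) < (n - b) choose r"
      using Cons.prems by (intro cascade_sum_less) auto
    then show ?thesis using Cons.prems cs by simp
  qed
qed

text \<open>
  A first violation of goodness occurs at a block of gain zero, so the cascade can be replaced by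
  the next filled block without loss; carrying this back through the list yields a larger good
  cascade or the whole block at \<open>p\<close>.
\<close>

lemma cascade_gain_le_good:
  assumes "cascade_adm n p r bs" "p + r \<le> n" "n + c < p + 2 * r"
  shows "(\<exists>cs. cascade_adm n p r cs \<and> cascade_good n c r cs \<and>
            cascade_sum n r bs \<le> cascade_sum n r cs \<and> cascade_gain n c r bs \<le> cascade_gain n c r cs)
         \<or> cascade_gain n c r bs \<le> block_gain n c p r"
  using assms
proof (induction bs arbitrary: p r)
  case Nil
  then show ?case by (intro disjI1 exI[of _ "[]"]) simp
next
  case (Cons b bs)
  have r: "0 < r" and b: "p < b" "b + r \<le> n" and bs: "cascade_adm n b (r - 1) bs"
    using Cons.prems by auto
  have b1: "b - 1 < n" "Suc (b - 1) = b" using b r by auto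
  note split = block_gain_split[OF b1(1) r, of c, unfolded b1(2)]
  show ?case
  proof (cases "n + c + 2 < b + 2 * r")
    case False
    \<comment> \<open>\<open>n + c < p + 2 * r\<close> and \<open>p < b\<close> leave only one way
      to violate goodness, with equality throughout; the half that follows \<open>b\<close> then has
      gain exactly 0.\<close>
    then have bp: "b = Suc p" and e: "b + 2 * (r - 1) = n + c"
      using Cons.prems b r by auto
    have 0: "block_gain n c b (r - 1) = 0"
      using e b r by (intro antisym block_gain_nonneg block_gain_nonpos) auto
    have "cascade_gain n c (r - 1) bs \<le> max 0 (block_gain n c b (r - 1))"
      using bs b r by (intro cascade_gain_le_max) auto
    then show ?thesis using 0 split bp by simp
  next
    case True
    have "(\<exists>cs. cascade_adm n b (r - 1) cs \<and> cascade_good n c (r - 1) cs \<and>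
            cascade_sum n (r - 1) bs \<le> cascade_sum n (r - 1) cs \<and>
            cascade_gain n c (r - 1) bs \<le> cascade_gain n c (r - 1) cs)
         \<or> cascade_gain n c (r - 1) bs \<le> block_gain n c b (r - 1)"
      using True b r by (intro Cons.IH[OF bs]) auto
    then show ?thesis
    proof (elim disjE exE conjE)
      fix cs
      assume "cascade_adm n b (r - 1) cs" "cascade_good n c (r - 1) cs"
        "cascade_sum n (r - 1) bs \<le> cascade_sum n (r - 1) cs"
        "cascade_gain n c (r - 1) bs \<le> cascade_gain n c (r - 1) cs"
      then show ?thesis using b r True by (intro disjI1 exI[of _ "b # cs"]) auto
    next
      assume "cascade_gain n c (r - 1) bs \<le> block_gain n c b (r - 1)"
      then have le: "cascade_gain n c r (b # bs) \<le> block_gain n c (b - 1) r"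
        using split by simp
      \<comment> \<open>The singleton \<open>[b - 1]\<close> is a good replacement unless
        \<open>b - 1 = p\<close> or \<open>b - 1 + 2 * r\<close> sits exactly at the threshold. In
        the latter case \<open>b - 1 = Suc p\<close> and the other half of the block at
        \<open>p\<close> has nonnegative gain, so the whole block does at least as well.\<close>
      consider "b = Suc p" | "b - 1 = Suc p" "b - 1 + 2 * r = n + c + 2"
        | "Suc p < b" "n + c + 2 < b - 1 + 2 * r"
        using b Cons.prems True by linarith
      then show ?thesis
      proof cases
        case 1
        then show ?thesis using le by simp
      next
        case 2
        have "block_gain n c p r = block_gain n c (b - 1) r + block_gain n c (b - 1) (r - 1)"
          using block_gain_split[of p n r c] 2 b r by simp
        moreover have "0 \<le> block_gain n c (b - 1) (r - 1)"
          using 2 b r by (intro block_gain_nonneg) auto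
        ultimately show ?thesis using le by simp
      next
        case 3
        have "cascade_adm n (b - 1) r (b # bs)" using Cons.prems 3 by simp
        then have "cascade_sum n r (b # bs) < (n - (b - 1)) choose r"
          using b by (intro cascade_sum_less) auto
        then show ?thesis using 3 r b le by (intro disjI1 exI[of _ "[b - 1]"]) auto
      qed
    qed
  qed
qed

section \<open>Gains as differences of cascade sums\<close>

lemma cascade_gain_below:
  "cascade_adm n p r bs \<Longrightarrow> r < c \<Longrightarrow> cascade_gain n c r bs = int (cascade_sum n r bs)"
proof (induction bs arbitrary: p r)
  case (Cons b bs)
  then have "cascade_gain n c (r - 1) bs = int (cascade_sum n (r - 1) bs)" by auto
  then show ?case using Cons.prems by (simp add: block_gain_def int_binomial_def)
qed simp

text \<open>The \<open>take\<close> retains the lower indices \<open>r - c, ..., 0\<close>. Later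
  entries have negative index and subtract nothing, whereas truncated subtraction in
  \<open>cascade_sum\<close> would count 1 for each of them.\<close>

lemma cascade_gain_eq:
  "cascade_adm n p r bs \<Longrightarrow> c \<le> r \<Longrightarrow>
   cascade_gain n c r bs =
     int (cascade_sum n r bs) - int (cascade_sum n (r - c) (take (Suc (r - c)) bs))"
proof (induction bs arbitrary: p r)
  case (Cons b bs)
  have blk: "block_gain n c b r = int ((n - b) choose r) - int ((n - b) choose (r - c))"
    using Cons.prems by (simp add: block_gain_def flip: of_nat_diff)
  show ?case
  proof (cases "r = c")
    case True
    then have "cascade_gain n c (r - 1) bs = int (cascade_sum n (r - 1) bs)"
      using Cons.prems by (intro cascade_gain_below) auto
    then show ?thesis using True blk by simp
  next
    case False
    then have "cascade_gain n c (r - 1) bs = int (cascade_sum n (r - 1) bs)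
       - int (cascade_sum n (r - 1 - c) (take (Suc (r - 1 - c)) bs))"
      using Cons.prems Cons.IH[of b "r - 1"] by auto
    moreover have "Suc (r - 1 - c) = r - c" "r - 1 - c = r - c - 1" using False Cons.prems by auto
    ultimately show ?thesis using blk by simp
  qed
qed simp

section \<open>The Kruskal--Katona theorem\<close>

definition shadow :: "'a set set \<Rightarrow> 'a set set" where
  "shadow F = {A - {x} | A x. A \<in> F \<and> x \<in> A}"

lemma shadowI:
  assumes "z \<notin> C" "insert z C \<in> F"
  shows "C \<in> shadow F"
proof -
  have "C = insert z C - {z}" using assms(1) by simp
  then show ?thesis using assms(2) unfolding shadow_def by blast
qed

lemma shadowE:
  assumes "C \<in> shadow F"
  obtains z where "z \<notin> C" "insert z C \<in> F"
proof -
  obtain A x where A: "A \<in> F" "x \<in> A" "C = A - {x}"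
    using assms unfolding shadow_def by blast
  then have "insert x C = A" by blast
  then show ?thesis using A that by blast
qed

text \<open>The compression of extremal set theory: \<open>y\<close> is exchanged for
  \<open>x\<close> unless the result is already a member, which keeps the map injective on
  \<open>F\<close>.\<close>

definition shift_set :: "'a \<Rightarrow> 'a \<Rightarrow> 'a set set \<Rightarrow> 'a set \<Rightarrow> 'a set" where
  "shift_set x y F A =
     (if y \<in> A \<and> x \<notin> A \<and> insert x (A - {y}) \<notin> F then insert x (A - {y}) else A)"

lemma inj_on_shift_set: "inj_on (shift_set x y F) F"
  by (rule inj_onI) (auto simp: shift_set_def split: if_splits)

text \<open>Sets with exactly one of \<open>x\<close> and \<open>y\<close> come in pairs related by
  the exchange. A pair with a single member in \<open>F\<close> ends up with its
  \<open>x\<close>-side; everything else is unchanged.\<close>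

lemma mem_shift_iff:
  assumes "x \<noteq> y"
  shows "B \<in> shift_set x y F ` F \<longleftrightarrow>
     (x \<in> B \<and> y \<notin> B \<and> (B \<in> F \<or> insert y (B - {x}) \<in> F)) \<or>
     (y \<in> B \<and> x \<notin> B \<and> B \<in> F \<and> insert x (B - {y}) \<in> F) \<or>
     ((x \<in> B \<longleftrightarrow> y \<in> B) \<and> B \<in> F)" (is "_ \<longleftrightarrow> ?R")
proof
  assume "B \<in> shift_set x y F ` F"
  then obtain A where A: "A \<in> F" "B = shift_set x y F A" by blast
  show ?R
  proof (cases "y \<in> A \<and> x \<notin> A \<and> insert x (A - {y}) \<notin> F")
    case True
    then have "insert y (B - {x}) = A" using A assms by (auto simp: shift_set_def)
    then show ?thesis using True A assms by (auto simp: shift_set_def)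
  next
    case False
    then have "B = A" using A(2) by (auto simp: shift_set_def)
    then show ?thesis using False A by blast
  qed
next
  assume R: ?R
  show "B \<in> shift_set x y F ` F"
  proof (cases "B \<in> F")
    case True
    then have "B = shift_set x y F B" using R by (auto simp: shift_set_def)
    then show ?thesis using True by blast
  next
    case False
    then have B: "x \<in> B" "y \<notin> B" "insert y (B - {x}) \<in> F" using R by auto
    have "insert x (insert y (B - {x}) - {y}) = B" using B assms by auto
    then have "B = shift_set x y F (insert y (B - {x}))"
      using B assms False by (auto simp: shift_set_def)
    then show ?thesis using B by blast
  qed
qed

text \<open>This is why compression never enlarges the shadow of a finite family: the right-hand
  side is an image of \<open>shadow F\<close>. The cases are the traces of a shadow set on
  \<open>{x, y}\<close>.\<close>

lemma shadow_shift_subset: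
  assumes "x \<noteq> y"
  shows "shadow (shift_set x y F ` F) \<subseteq> shift_set x y (shadow F) ` shadow F"
proof
  fix C
  assume "C \<in> shadow (shift_set x y F ` F)"
  then obtain z where z: "z \<notin> C" "insert z C \<in> shift_set x y F ` F"
    by (rule shadowE)
  note zF = z(2)[unfolded mem_shift_iff[OF assms]]
  consider "x \<in> C" "y \<in> C" | "x \<notin> C" "y \<notin> C" | "x \<in> C" "y \<notin> C" | "x \<notin> C" "y \<in> C"
    by blast
  then show "C \<in> shift_set x y (shadow F) ` shadow F"
  proof cases
    case 1
    then have "insert z C \<in> F" using z zF by auto
    then have "C \<in> shadow F" using z by (intro shadowI)
    then show ?thesis using 1 mem_shift_iff[OF assms, of C "shadow F"] by simp
  next
    case 2
    have "insert z C \<in> F \<or> insert y C \<in> F"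
    proof (cases "z = x")
      case True
      then have "insert y (insert z C - {x}) = insert y C" using 2 by auto
      then show ?thesis using zF True 2 assms by auto
    next
      case False
      then show ?thesis using zF 2 assms by auto
    qed
    then have "C \<in> shadow F" using z 2 shadowI by metis
    then show ?thesis using 2 mem_shift_iff[OF assms, of C "shadow F"] by simp
  next
    case 3
    have eq: "insert y (insert z C - {x}) = insert z (insert y (C - {x}))" using 3 z by auto
    have "insert z C \<in> F \<or> z \<noteq> y \<and> insert z (insert y (C - {x})) \<in> F"
      using zF 3 assms unfolding eq by blast
    then have "C \<in> shadow F \<or> insert y (C - {x}) \<in> shadow F"
      using z shadowI[of z C F] shadowI[of z "insert y (C - {x})" F] by auto
    then show ?thesis using 3 mem_shift_iff[OF assms, of C "shadow F"] by simp
  next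
    case 4
    have zC: "insert z C \<in> F" using zF z 4 assms by auto
    then have "C \<in> shadow F" using z by (intro shadowI)
    moreover have "insert x (C - {y}) \<in> shadow F"
    proof (cases "z = x")
      case True
      have "insert y (insert x (C - {y})) = insert z C" using True 4 by auto
      then show ?thesis using zC assms by (intro shadowI[of y]) auto
    next
      case False
      have "insert x (insert z C - {y}) = insert z (insert x (C - {y}))" using 4 z by auto
      then show ?thesis using zF z 4 assms False by (intro shadowI[of z]) auto
    qed
    ultimately show ?thesis using 4 mem_shift_iff[OF assms, of C "shadow F"] by simp
  qed
qed

lemma finite_uniform: "finite X \<Longrightarrow> F \<subseteq> {A. A \<subseteq> X \<and> card A = r} \<Longrightarrow> finite F"
  by (rule finite_subset[of _ "Pow X"]) auto

lemma shadow_uniform: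
  assumes "finite X" "F \<subseteq> {A. A \<subseteq> X \<and> card A = r}"
  shows "shadow F \<subseteq> {A. A \<subseteq> X \<and> card A = r - 1}"
proof
  fix C
  assume "C \<in> shadow F"
  then obtain A x where "A \<in> F" "x \<in> A" "C = A - {x}" by (auto simp: shadow_def)
  then show "C \<in> {A. A \<subseteq> X \<and> card A = r - 1}" using assms by (auto simp: card_Diff_singleton)
qed

text \<open>Among the families of this size with no larger shadow, take one with the most members
  through \<open>x\<close>. If an exchange led out of it, compression would keep all members through
  \<open>x\<close> and add another.\<close>

lemma exists_shifted:
  assumes X: "finite X" "x \<in> X" and F: "F \<subseteq> {A. A \<subseteq> X \<and> card A = r}"
  obtains G where "G \<subseteq> {A. A \<subseteq> X \<and> card A = r}" "card G = card F"
    "card (shadow G) \<le> card (shadow F)"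
    "\<And>A y. A \<in> G \<Longrightarrow> y \<in> A \<Longrightarrow> x \<notin> A \<Longrightarrow> insert x (A - {y}) \<in> G"
proof -
  define P where "P G \<longleftrightarrow> G \<subseteq> {A. A \<subseteq> X \<and> card A = r} \<and> card G = card F \<and>
    card (shadow G) \<le> card (shadow F)" for G
  define w where "w G = card {A \<in> G. x \<in> A}" for G
  have fin: "finite G" if "P G" for G
    using that finite_uniform[OF X(1)] by (auto simp: P_def)
  have "w G < Suc (card F)" if "P G" for G
    using fin[OF that] that card_mono[of G "{A \<in> G. x \<in> A}"] by (auto simp: P_def w_def)
  moreover have "P F" using F by (simp add: P_def)
  ultimately obtain G where G: "P G" and max: "\<And>H. P H \<Longrightarrow> w H \<le> w G"
    using ex_has_greatest_nat[of P F w "Suc (card F)"] by blast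
  have "insert x (A - {y}) \<in> G" if A: "A \<in> G" "y \<in> A" "x \<notin> A" for A y
  proof (rule ccontr)
    assume notin: "insert x (A - {y}) \<notin> G"
    have xy: "x \<noteq> y" using A by auto
    define H where "H = shift_set x y G ` G"
    have "card B = r \<and> B \<subseteq> X" if "B \<in> H" for B
    proof -
      obtain D where D: "D \<in> G" "B = shift_set x y G D" using \<open>B \<in> H\<close> by (auto simp: H_def)
      then have Dr: "D \<subseteq> X" "card D = r" using G by (auto simp: P_def)
      have D_fin: "finite D" using Dr X finite_subset by blast
      then have "Suc (card D - Suc 0) = card D" if "y \<in> D"
        using that card_gt_0_iff[of D] by auto
      moreover have "card B = Suc (card D - Suc 0) \<or> B = D" "B \<subseteq> X" "B = D \<or> y \<in> D"
        using D Dr X D_fin by (auto simp: shift_set_def card_insert_if card_Diff_singleton)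
      ultimately show ?thesis using Dr by metis
    qed
    moreover have "card H = card F"
    proof -
      have "card H = card G" unfolding H_def by (rule card_image[OF inj_on_shift_set])
      moreover have "card G = card F" using G unfolding P_def by blast
      ultimately show ?thesis by (rule trans)
    qed
    moreover have "card (shadow H) \<le> card (shadow F)"
    proof -
      have fs: "finite (shadow G)"
        using G unfolding P_def
        by (intro finite_uniform[OF X(1) shadow_uniform[OF X(1)]]) (rule conjunct1)
      have "card (shadow H) \<le> card (shift_set x y (shadow G) ` shadow G)"
        unfolding H_def using fs shadow_shift_subset[OF xy] by (intro card_mono) auto
      also have "\<dots> \<le> card (shadow G)" using fs by (rule card_image_le)
      finally show ?thesis using G by (simp add: P_def)
    qed
    ultimately have PH: "P H" unfolding P_def by blast
    have "{A \<in> G. x \<in> A} \<subset> {A \<in> H. x \<in> A}"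
    proof
      show "{A \<in> G. x \<in> A} \<subseteq> {A \<in> H. x \<in> A}"
        unfolding H_def mem_shift_iff[OF xy] by auto
      have "insert x (A - {y}) \<in> H"
        using A notin unfolding H_def by (intro image_eqI[of _ _ A]) (auto simp: shift_set_def)
      then show "{A \<in> G. x \<in> A} \<noteq> {A \<in> H. x \<in> A}" using notin by blast
    qed
    then have "w G < w H"
      unfolding w_def using fin[OF PH] by (intro psubset_card_mono) auto
    then show False using max[OF PH] by simp
  qed
  then show ?thesis using that G by (auto simp: P_def)
qed

section \<open>Cascade sums under Pascal's rule\<close>

text \<open>The two summands serve as target sizes for the members avoiding a point and for the link
  of that point.\<close>

lemma cascade_sum_pascal:
  "cascade_adm n p r bs \<Longrightarrow>
   cascade_sum n r bs = cascade_sum (n - 1) r bs + cascade_sum (n - 1) (r - 1) bs"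
proof (induction bs arbitrary: p r)
  case (Cons b bs)
  then obtain q where q: "r = Suc q" by (cases r) auto
  have m: "n - b = Suc (n - 1 - b)" using Cons.prems q by auto
  have "cascade_sum n q bs = cascade_sum (n - 1) q bs + cascade_sum (n - 1) (q - 1) bs"
    using Cons q by auto
  then show ?case using q by (simp add: m)
qed simp

lemma cascade_adm_take:
  assumes "cascade_adm n p r bs" "n + s \<le> m + r"
  shows "cascade_adm m p s (take s bs)"
  unfolding cascade_adm_altdef
proof (intro conjI allI impI ballI)
  show "sorted_wrt (<) (take s bs)" "length (take s bs) \<le> s"
    using assms(1) unfolding cascade_adm_altdef by (auto simp: sorted_wrt_take)
  show "p < b" if "b \<in> set (take s bs)" for b
    using assms(1) that unfolding cascade_adm_altdef by (auto dest: in_set_takeD)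
  fix i
  assume "i < length (take s bs)"
  then have "take s bs ! i + r \<le> n + i"
    using assms(1) unfolding cascade_adm_altdef by simp
  then show "take s bs ! i + s \<le> m + i" using assms(2) by linarith
qed

lemma cascade_sum_take_le: "cascade_sum n r (take t bs) \<le> cascade_sum n r bs"
proof (induction bs arbitrary: r t)
  case (Cons b bs)
  then show ?case by (cases t) auto
qed simp

text \<open>An \<open>r\<close>-th entry has lower index 0 here: it contributes 1 to the first
  summand on the right, and \<open>take (r - 1)\<close> keeps it out of the second.\<close>

lemma cascade_sum_pascal_shadow:
  "cascade_adm n p r bs \<Longrightarrow>
   cascade_sum n (r - 1) bs =
     cascade_sum (n - 1) (r - 1) bs + cascade_sum (n - 1) (r - 1 - 1) (take (r - 1) bs)"
proof (induction bs arbitrary: p r)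
  case (Cons b bs)
  then obtain q where q: "r = Suc q" by (cases r) auto
  have m: "n - b = Suc (n - 1 - b)" using Cons.prems q by auto
  show ?case
  proof (cases q)
    case 0
    then have "bs = []" using Cons.prems q by (cases bs) auto
    then show ?thesis using 0 q by simp
  next
    case (Suc q')
    then have "cascade_sum n q' bs = cascade_sum (n - 1) q' bs + cascade_sum (n - 1) (q' - 1) (take q' bs)"
      using Cons.IH[of b q] Cons.prems q by simp
    then show ?thesis using q Suc by (simp add: m)
  qed
qed simp

text \<open>Admissibility forces the entries to be consecutive from \<open>n - r\<close> on, so each
  of the at most \<open>r\<close> summands is 1.\<close>

lemma cascade_sum_degenerate:
  "cascade_adm n p r bs \<Longrightarrow> n \<le> p + r + 1 \<Longrightarrow> cascade_sum (n - 1) (r - 1) bs \<le> r"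
proof (induction bs arbitrary: p r)
  case (Cons b bs)
  then have b: "b + r = n" "0 < r" by auto
  then have "n - 1 - b = r - 1" by auto
  moreover have "cascade_sum (n - 1) (r - 1 - 1) bs \<le> r - 1"
    using Cons b by (intro Cons.IH[of b "r - 1"]) auto
  ultimately show ?case using b by simp
qed simp

text \<open>
  Lowering all upper entries by one may destroy admissibility of the cascade; one extra set
  suffices to repair it without lowering the bound on the shadow.
\<close>

lemma cascade_successor:
  "cascade_adm n p r bs \<Longrightarrow> p + r + 2 \<le> n \<Longrightarrow>
   \<exists>cs. cascade_adm (n - 1) p r cs \<and>
        cascade_sum (n - 1) r cs \<le> Suc (cascade_sum (n - 1) r bs) \<and>
        cascade_sum (n - 1) (r - 1) bs \<le> cascade_sum (n - 1) (r - 1) cs"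
proof (induction bs arbitrary: p r)
  case Nil
  then show ?case by (intro exI[of _ "[]"]) simp
next
  case (Cons b bs)
  then have b: "p < b" "0 < r" "b + r \<le> n" "cascade_adm n b (r - 1) bs" by auto
  show ?case
  proof (cases "b + r = n")
    case True
    \<comment> \<open>The singleton \<open>[b - 1]\<close> over \<open>n - 1\<close> has sum
      \<open>r choose r = 1\<close>, the one extra set, and \<open>r choose (r - 1) = r\<close>
      dominates the degenerate cascade.\<close>
    have m: "n - Suc (b - Suc 0) = r" "n - 1 - (b - 1) = r" using True b by auto
    have "cascade_sum (n - 1) (r - 1) (b # bs) \<le> r"
      using True Cons.prems by (intro cascade_sum_degenerate[of n "b - 1"]) auto
    moreover have "r choose (r - 1) = r" using b binomial_symmetric[of "r - 1" r] by simp
    ultimately show ?thesis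
      using True b Cons.prems m by (intro exI[of _ "[b - 1]"]) auto
  next
    case False
    then obtain cs where "cascade_adm (n - 1) b (r - 1) cs"
      "cascade_sum (n - 1) (r - 1) cs \<le> Suc (cascade_sum (n - 1) (r - 1) bs)"
      "cascade_sum (n - 1) (r - 1 - 1) bs \<le> cascade_sum (n - 1) (r - 1 - 1) cs"
      using Cons.IH[of b "r - 1"] b by auto
    then show ?thesis using b False by (intro exI[of _ "b # cs"]) auto
  qed
qed

text \<open>At the top there may be no room for the entry \<open>b - 1\<close>. In the degenerate
  case \<open>[b]\<close> over the unchanged \<open>n\<close> serves instead, which is why
  \<open>m\<close> is left free.\<close>

lemma cascade_successor_top:
  assumes "cascade_adm n p r bs"
  shows "\<exists>m cs. cascade_adm m p r cs \<and>
        cascade_sum m r cs \<le> Suc (cascade_sum (n - 1) r bs) \<and>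
        cascade_sum (n - 1) (r - 1) bs \<le> cascade_sum m (r - 1) cs"
proof (cases bs)
  case Nil
  then show ?thesis by (intro exI[of _ n] exI[of _ "[]"]) simp
next
  case (Cons b bs')
  then have b: "p < b" "0 < r" "b + r \<le> n" "cascade_adm n b (r - 1) bs'" using assms by auto
  show ?thesis
  proof (cases "b + r = n")
    case True
    have m: "n - b = r" using True by simp
    have "cascade_sum (n - 1) (r - 1) (b # bs') \<le> r"
      using True assms Cons b by (intro cascade_sum_degenerate[of n "b - 1"]) auto
    moreover have "r choose (r - 1) = r" using b binomial_symmetric[of "r - 1" r] by simp
    ultimately show ?thesis
      using True b Cons m by (intro exI[of _ n] exI[of _ "[b]"]) auto
  next
    case False
    then obtain cs where "cascade_adm (n - 1) b (r - 1) cs"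
      "cascade_sum (n - 1) (r - 1) cs \<le> Suc (cascade_sum (n - 1) (r - 1) bs')"
      "cascade_sum (n - 1) (r - 1 - 1) bs' \<le> cascade_sum (n - 1) (r - 1 - 1) cs"
      using cascade_successor[of n b "r - 1" bs'] b by auto
    then show ?thesis using b False Cons by (intro exI[of _ "n - 1"] exI[of _ "b # cs"]) auto
  qed
qed

text \<open>
  Frankl's argument: after shifting towards \<open>x\<close>, the shadow of the members avoiding \<open>x\<close> is
  contained in the link of \<open>x\<close>, so by induction the link cannot be small, and its own shadow
  supplies the second summand of Pascal's rule.
\<close>

lemma kruskal_katona:
  assumes "finite X" "F \<subseteq> {A. A \<subseteq> X \<and> card A = r}"
    and "cascade_adm n p r bs" "cascade_sum n r bs \<le> card F"
  shows "cascade_sum n (r - 1) bs \<le> card (shadow F)"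
  using assms
proof (induction X arbitrary: F r n p bs rule: finite_induct)
  case empty
  show ?case
  proof (cases "bs = []")
    case False
    then have "0 < r" using empty by (cases bs) auto
    then have "F = {}" using empty by auto
    then show ?thesis using cascade_sum_pos[OF empty(2)] empty False by simp
  qed simp
next
  case (insert x X)
  show ?case
  proof (cases "bs = []")
    case False
    then have r: "0 < r" using insert.prems by (cases bs) auto
    have fX: "finite (insert x X)" using insert by simp
    obtain G where G: "G \<subseteq> {A. A \<subseteq> insert x X \<and> card A = r}" "card G = card F"
      "card (shadow G) \<le> card (shadow F)"
      and shifted: "\<And>A y. A \<in> G \<Longrightarrow> y \<in> A \<Longrightarrow> x \<notin> A \<Longrightarrow> insert x (A - {y}) \<in> G"
      using exists_shifted[OF fX insertI1 insert.prems(1)] by blast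
    have finG: "finite G" using finite_uniform[OF fX G(1)] .
    define L where "L = (\<lambda>A. A - {x}) ` {A \<in> G. x \<in> A}"
    define D where "D = {A \<in> G. x \<notin> A}"
    have "inj_on (\<lambda>A. A - {x}) {A \<in> G. x \<in> A}"
      by (rule inj_onI) auto
    then have "card L = card {A \<in> G. x \<in> A}" unfolding L_def by (rule card_image)
    moreover have "card G = card ({A \<in> G. x \<in> A} \<union> D)"
      by (rule arg_cong[of _ _ card]) (auto simp: D_def)
    moreover have "\<dots> = card {A \<in> G. x \<in> A} + card D"
      using finG by (intro card_Un_disjoint) (auto simp: D_def)
    ultimately have cardG: "card G = card L + card D" by simp
    have L: "L \<subseteq> {A. A \<subseteq> X \<and> card A = r - 1}"
      using G(1) by (auto simp: L_def card_Diff_singleton)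
    have D: "D \<subseteq> {A. A \<subseteq> X \<and> card A = r}" using G(1) by (auto simp: D_def)
    have finL: "finite L" and fsL: "finite (shadow L)" and fsG: "finite (shadow G)"
      using finite_uniform[OF insert.hyps(1) L]
        finite_uniform[OF insert.hyps(1) shadow_uniform[OF insert.hyps(1) L]]
        finite_uniform[OF fX shadow_uniform[OF fX G(1)]] by auto
    have "shadow D \<subseteq> L"
    proof
      fix C
      assume "C \<in> shadow D"
      then obtain A y where A: "A \<in> G" "x \<notin> A" "y \<in> A" "C = A - {y}"
        by (auto simp: shadow_def D_def)
      have "insert x (A - {y}) \<in> G" using shifted A by blast
      moreover have "C = insert x (A - {y}) - {x}" using A by auto
      ultimately show "C \<in> L" unfolding L_def by blast
    qed
    then have DL: "card (shadow D) \<le> card L" using finL by (rule card_mono[rotated])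
    have "L \<subseteq> shadow G" by (auto simp: L_def shadow_def)
    moreover have "insert x ` shadow L \<subseteq> shadow G"
    proof
      fix C
      assume "C \<in> insert x ` shadow L"
      then obtain A z where A: "A \<in> G" "x \<in> A" "z \<in> A" "z \<noteq> x" "C = insert x (A - {x} - {z})"
        by (auto simp: shadow_def L_def)
      then have "C = A - {z}" by auto
      then show "C \<in> shadow G" using A by (auto simp: shadow_def)
    qed
    ultimately have sub: "L \<union> insert x ` shadow L \<subseteq> shadow G" by blast
    have x_notin: "x \<notin> A" if "A \<in> L \<or> A \<in> shadow L" for A
      using that by (auto simp: L_def shadow_def)
    have "inj_on (insert x) (shadow L)"
      using x_notin by (intro inj_onI) (metis insert_ident)
    then have "card (L \<union> insert x ` shadow L) = card L + card (shadow L)"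
      using finL fsL x_notin by (subst card_Un_disjoint) (auto simp: card_image)
    then have LG: "card L + card (shadow L) \<le> card (shadow G)"
      using card_mono[OF fsG sub] by simp
    have adm: "cascade_adm n p r bs" by fact
    have 1: "cascade_sum (n - 1) (r - 1) bs \<le> card L"
    proof (rule ccontr)
      assume small: "\<not> ?thesis"
      \<comment> \<open>A link below its target leaves \<open>D\<close> at least one set above its
        own target, the surplus that the successor cascade requires; the shadow of \<open>D\<close>
        would then be too large for the link.\<close>
      obtain m cs where cs: "cascade_adm m p r cs"
        "cascade_sum m r cs \<le> Suc (cascade_sum (n - 1) r bs)"
        "cascade_sum (n - 1) (r - 1) bs \<le> cascade_sum m (r - 1) cs"
        using cascade_successor_top[OF adm] by blast
      have "cascade_sum m r cs \<le> card D"
        using cs small cascade_sum_pascal[OF adm] cardG G(2) insert.prems(3) by linarith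
      then have "cascade_sum m (r - 1) cs \<le> card (shadow D)"
        using insert.IH[OF D cs(1)] by simp
      then show False using DL cs small by linarith
    qed
    \<comment> \<open>The link is \<open>(r - 1)\<close>-uniform, so the induction hypothesis admits
      at most \<open>r - 1\<close> entries.\<close>
    moreover have "cascade_sum (n - 1) (r - 1 - 1) (take (r - 1) bs) \<le> card (shadow L)"
    proof (rule insert.IH[OF L])
      show "cascade_adm (n - 1) p (r - 1) (take (r - 1) bs)"
        using adm r False by (intro cascade_adm_take[OF adm]) (cases bs; auto)
      show "cascade_sum (n - 1) (r - 1) (take (r - 1) bs) \<le> card L"
        using 1 cascade_sum_take_le le_trans by blast
    qed
    ultimately show ?thesis using cascade_sum_pascal_shadow[OF adm] LG G(3) by linarith
  qed simp
qed

section \<open>Iterated shadows\<close>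

lemma iterated_shadow_uniform:
  assumes "finite X" "F \<subseteq> {A. A \<subseteq> X \<and> card A = r}"
  shows "(shadow ^^ c) F \<subseteq> {A. A \<subseteq> X \<and> card A = r - c}"
proof (induction c)
  case (Suc c)
  then show ?case using shadow_uniform[OF assms(1) Suc] by simp
qed (use assms in simp)

lemma iterated_shadow_subset: "C \<in> (shadow ^^ c) F \<Longrightarrow> \<exists>A\<in>F. C \<subseteq> A"
proof (induction c arbitrary: C)
  case (Suc c)
  then have "C \<in> shadow ((shadow ^^ c) F)" by simp
  then obtain z where "insert z C \<in> (shadow ^^ c) F" by (rule shadowE)
  then show ?case using Suc.IH by blast
qed auto

lemma kruskal_katona_iterated:
  assumes "finite X" "F \<subseteq> {A. A \<subseteq> X \<and> card A = r}"
    and "cascade_adm n p r bs" "cascade_sum n r bs \<le> card F" "c \<le> r"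
  shows "cascade_sum n (r - c) (take (Suc (r - c)) bs) \<le> card ((shadow ^^ c) F)"
  using \<open>c \<le> r\<close>
proof (induction c)
  case 0
  show ?case using le_trans[OF cascade_sum_take_le assms(4)] by simp
next
  case (Suc c)
  \<comment> \<open>An entry with lower index 0 is dropped before the next shadow is taken, since an
    admissible cascade with top index \<open>r - c\<close> has at most \<open>r - c\<close>
    entries.\<close>
  have "cascade_sum n (r - c) (take (r - c) bs) \<le> cascade_sum n (r - c) (take (Suc (r - c)) bs)"
    using cascade_sum_take_le[of n "r - c" "r - c" "take (Suc (r - c)) bs"] by (simp add: min_def)
  also have "\<dots> \<le> card ((shadow ^^ c) F)" using Suc by simp
  finally have "cascade_sum n (r - c) (take (r - c) bs) \<le> card ((shadow ^^ c) F)" .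
  moreover have "cascade_adm n p (r - c) (take (r - c) bs)"
    by (rule cascade_adm_take[OF assms(3)]) simp
  ultimately have "cascade_sum n (r - c - 1) (take (r - c) bs) \<le> card (shadow ((shadow ^^ c) F))"
    using kruskal_katona[OF assms(1) iterated_shadow_uniform[OF assms(1,2)]] by blast
  moreover have "r - c = Suc (r - Suc c)" using Suc.prems by simp
  ultimately show ?case by simp
qed

section \<open>Cross-intersecting families\<close>

lemma cross_intersecting_card_le:
  assumes X: "finite X" "card X = N"
    and A: "A \<subseteq> {S. S \<subseteq> X \<and> card S = a}" and B: "B \<subseteq> {S. S \<subseteq> X \<and> card S = b}"
    and cross: "\<And>S T. S \<in> A \<Longrightarrow> T \<in> B \<Longrightarrow> S \<inter> T \<noteq> {}"
    and ab: "a + b \<le> N"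
    and cascade: "cascade_adm n p (N - b) bs" "cascade_sum n (N - b) bs = card B"
  shows "card A + cascade_sum n a (take (Suc a) bs) \<le> N choose a"
proof -
  define F where "F = (\<lambda>T. X - T) ` B"
  \<comment> \<open>This many shadows lower the complements of the members of \<open>B\<close> from
    size \<open>N - b\<close> to size \<open>a\<close>; every set reached is disjoint from some
    member of \<open>B\<close>.\<close>
  define c where "c = N - b - a"
  define U where "U = (shadow ^^ c) F"
  have a: "N - b - c = a" "c \<le> N - b" using ab by (auto simp: c_def)
  have "inj_on (\<lambda>T. X - T) B" using B by (intro inj_onI) blast
  then have cardF: "card F = card B" unfolding F_def by (rule card_image)
  have F: "F \<subseteq> {S. S \<subseteq> X \<and> card S = N - b}"
    using B X by (auto simp: F_def card_Diff_subset finite_subset)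
  have U: "U \<subseteq> {S. S \<subseteq> X \<and> card S = a}"
    using iterated_shadow_uniform[OF X(1) F, of c] a by (simp add: U_def)
  have le: "cascade_sum n a (take (Suc a) bs) \<le> card U"
    using kruskal_katona_iterated[OF X(1) F cascade(1) _ a(2)] cascade(2) cardF a
    by (simp add: U_def)
  have "A \<inter> U = {}"
  proof (rule ccontr)
    assume "A \<inter> U \<noteq> {}"
    then obtain S where S: "S \<in> A" "S \<in> U" by blast
    then obtain T where "T \<in> B" "S \<subseteq> X - T"
      using iterated_shadow_subset[of S c F] by (auto simp: U_def F_def)
    then show False using cross[OF S(1)] by blast
  qed
  then have "card A + card U = card (A \<union> U)"
    using finite_uniform[OF X(1)] A U by (intro card_Un_disjoint[symmetric]) blast+
  also have "\<dots> \<le> card {S. S \<subseteq> X \<and> card S = a}"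
    using A U finite_uniform[OF X(1)] by (intro card_mono) blast+
  also have "\<dots> = N choose a" using n_subsets[OF X(1)] X(2) by simp
  finally show ?thesis using le by simp
qed

section \<open>The extremal pair\<close>

lemma insert_uniform:
  assumes "P \<subseteq> {S. S \<subseteq> {Suc q..n} \<and> card S = w}" "q \<le> n"
  shows "insert q ` P \<subseteq> {S. S \<subseteq> {q..n} \<and> card S = Suc w}"
    and "card (insert q ` P) = card P"
proof -
  have fin: "finite S" and notin: "q \<notin> S" if "S \<in> P" for S
    using subsetD[OF assms(1) that] finite_subset[of S "{Suc q..n}"] by auto
  then have "S \<subseteq> {Suc q..n} \<and> card (insert q S) = Suc w" if "S \<in> P" for S
    using that assms(1) fin notin by auto
  then show "insert q ` P \<subseteq> {S. S \<subseteq> {q..n} \<and> card S = Suc w}"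
    using assms(2) by fastforce
  have "inj_on (insert q) P"
  proof (rule inj_onI)
    fix S T
    assume "S \<in> P" "T \<in> P" "insert q S = insert q T"
    then show "S = T" using notin insert_ident[of q S T] by simp
  qed
  then show "card (insert q ` P) = card P" by (rule card_image)
qed

text \<open>Lexicographic segments are built by deciding on the least element \<open>q\<close>. If
  \<open>q\<close> is an entry, \<open>B\<close> receives all sets through \<open>q\<close> and
  \<open>A\<close> only sets through \<open>q\<close>; otherwise the roles are exchanged. The
  recursion handles what remains. The last conjunct later makes \<open>B\<close> itself
  intersecting.\<close>

lemma exists_cross_intersecting:
  assumes "cascade_adm n p r bs" "length bs \<le> v"
  shows "\<exists>A B. A \<subseteq> {S. S \<subseteq> {Suc p..n} \<and> card S = v} \<and>
     B \<subseteq> {S. S \<subseteq> {Suc p..n} \<and> card S = n - p - r} \<and>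
     (\<forall>S\<in>A. \<forall>T\<in>B. S \<inter> T \<noteq> {}) \<and>
     card B = cascade_sum n r bs \<and> card A + cascade_sum n v bs = (n - p) choose v \<and>
     (cascade_adm n (Suc p) r bs \<longrightarrow> (\<forall>T\<in>B. Suc p \<in> T))"
  using assms
proof (induction "n - p" arbitrary: p r v bs)
  case 0
  then have "bs = []" by (cases bs) auto
  then show ?case
    by (intro exI[of _ "{S. S \<subseteq> {Suc p..n} \<and> card S = v}"] exI[of _ "{}"]) (simp add: n_subsets)
next
  case (Suc m)
  show ?case
  proof (cases bs)
    case Nil
    then show ?thesis
      by (intro exI[of _ "{S. S \<subseteq> {Suc p..n} \<and> card S = v}"] exI[of _ "{}"]) (simp add: n_subsets)
  next
    case (Cons b bs')
    have b: "p < b" "0 < r" "b + r \<le> n" "cascade_adm n b (r - 1) bs'"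
      using Suc.prems Cons by auto
    define q where "q = Suc p"
    have q: "q \<le> n" "n - p = Suc (n - q)" "m = n - q" "n - q - (r - 1) = n - p - r"
      "Suc (n - q - r) = n - p - r"
      using b Suc.hyps by (auto simp: q_def)
    obtain w where w: "v = Suc w" using Suc.prems Cons by (cases v) auto
    define E where "E s = {S. S \<subseteq> {Suc q..n} \<and> card S = s}" for s
    have E: "finite (E s)" "card (E s) = (n - q) choose s" for s
      unfolding E_def by (auto simp: n_subsets)
    have mono: "P \<subseteq> {S. S \<subseteq> {q..n} \<and> card S = s}" if "P \<subseteq> E s" for P s
      using that by (fastforce simp: E_def)
    have notin: "q \<notin> S" if "S \<in> E s" for S s using that by (auto simp: E_def)
    show ?thesis
    proof (cases "b = q")
      case True
      obtain A B where A: "A \<subseteq> E w" and B: "B \<subseteq> E (n - p - r)"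
        and cross: "\<forall>S\<in>A. \<forall>T\<in>B. S \<inter> T \<noteq> {}"
        and card: "card B = cascade_sum n (r - 1) bs'"
          "card A + cascade_sum n w bs' = (n - q) choose w"
        using Suc.hyps(1)[OF q(3), of "r - 1" bs' w] b True Suc.prems(2) Cons w q
        unfolding E_def by auto
      let ?B = "insert q ` E (n - q - r) \<union> B"
      note I = insert_uniform[OF _ q(1), folded E_def]
      have 1: "insert q ` A \<subseteq> {S. S \<subseteq> {q..n} \<and> card S = v}" using I(1)[OF A] w by simp
      have 2: "?B \<subseteq> {S. S \<subseteq> {q..n} \<and> card S = n - p - r}"
        using I(1)[of "E (n - q - r)" "n - q - r"] mono[OF B] q(5) by simp
      have 3: "\<forall>S\<in>insert q ` A. \<forall>T\<in>?B. S \<inter> T \<noteq> {}" using cross by blast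
      have disj: "insert q ` E (n - q - r) \<inter> B = {}" using B notin by blast
      have "card ?B = card (E (n - q - r)) + card B"
        using E notin finite_subset[OF B E(1)] I(2)[of "E (n - q - r)" "n - q - r"] disj
        by (subst card_Un_disjoint) auto
      also have "card (E (n - q - r)) = (n - q) choose r"
        using E binomial_symmetric[of r "n - q"] b True by simp
      finally have 4: "card ?B = cascade_sum n r bs" using card Cons True by simp
      have 5: "card (insert q ` A) + cascade_sum n v bs = (n - p) choose v"
        using I(2)[OF A] card Cons True w q(2) by simp
      have 6: "\<not> cascade_adm n (Suc p) r bs" using Cons True by (simp add: q_def)
      show ?thesis using 1 2 3 4 5 6 unfolding q_def by blast
    next
      case False
      then have adm: "cascade_adm n q r bs" using Suc.prems(1) Cons by (auto simp: q_def)
      obtain A B where A: "A \<subseteq> E v" and B: "B \<subseteq> E (n - q - r)"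
        and cross: "\<forall>S\<in>A. \<forall>T\<in>B. S \<inter> T \<noteq> {}"
        and card: "card B = cascade_sum n r bs"
          "card A + cascade_sum n v bs = (n - q) choose v"
        using Suc.hyps(1)[OF q(3) adm Suc.prems(2)] unfolding E_def by auto
      let ?A = "insert q ` E w \<union> A"
      note I = insert_uniform[OF _ q(1), folded E_def]
      have 1: "?A \<subseteq> {S. S \<subseteq> {q..n} \<and> card S = v}"
        using I(1)[of "E w" w] mono[OF A] w by simp
      have 2: "insert q ` B \<subseteq> {S. S \<subseteq> {q..n} \<and> card S = n - p - r}"
        using I(1)[OF B] q False b by (simp add: q_def)
      have 3: "\<forall>S\<in>?A. \<forall>T\<in>insert q ` B. S \<inter> T \<noteq> {}" using cross by blast
      have 4: "card (insert q ` B) = cascade_sum n r bs" using I(2)[OF B] card by simp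
      have disj: "insert q ` E w \<inter> A = {}" using A notin by blast
      have "card ?A = card (E w) + card A"
        using E notin finite_subset[OF A E(1)] I(2)[of "E w" w] disj
        by (subst card_Un_disjoint) auto
      then have 5: "card ?A + cascade_sum n v bs = (n - p) choose v"
        using E card w q(2) by simp
      have 6: "\<forall>T\<in>insert q ` B. Suc p \<in> T" by (simp add: q_def)
      show ?thesis using 1 2 3 4 5 6 unfolding q_def by blast
    qed
  qed
qed

section \<open>The dual cascade\<close>

text \<open>For \<open>p = 1\<close> this lists \<open>S\<^sub>\<gamma>\<close> when the given list is \<open>T\<^sub>\<gamma>\<close>.\<close>

fun dual_cascade :: "nat \<Rightarrow> nat list \<Rightarrow> nat list" where
  "dual_cascade p [] = []"
| "dual_cascade p [b] = [Suc p..<Suc b]"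
| "dual_cascade p (b # bs) = [Suc p..<b] @ dual_cascade b bs"

text \<open>All entries but the last lie inside the interval and cancel; the last lies just beyond
  it and survives, hence the singleton clause of \<open>dual_cascade\<close> ends with
  \<open>b\<close> itself.\<close>

lemma set_dual_cascade:
  "sorted_wrt (<) (p # bs) \<Longrightarrow> bs \<noteq> [] \<Longrightarrow>
   set (dual_cascade p bs) = sym_diff (set bs) {Suc p..last bs - 1}"
proof (induction p bs rule: dual_cascade.induct)
  case (3 p b c cs)
  define C l where "C = set (c # cs)" and "l = last (c # cs)"
  have C: "\<forall>x\<in>C. b < x" "p < b" using "3.prems" by (auto simp: C_def)
  have "l \<in> C" unfolding C_def l_def by (rule last_in_set) simp
  then have "b < l" using C by blast
  then have "{Suc p..<b} \<union> sym_diff C {Suc b..l - 1} = sym_diff (insert b C) {Suc p..l - 1}"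
    using C by (intro set_eqI) (auto; fastforce)
  moreover have "set (dual_cascade b (c # cs)) = sym_diff (set (c # cs)) {Suc b..last (c # cs) - 1}"
    using "3.prems" by (intro "3.IH") auto
  ultimately show ?case by (simp add: C_def l_def del: last.simps add: last_ConsR)
qed auto

lemma sorted_dual_cascade:
  "sorted_wrt (<) (p # bs) \<Longrightarrow> sorted_wrt (<) (p # dual_cascade p bs)"
proof (induction p bs rule: dual_cascade.induct)
  case (3 p b c cs)
  have "sorted_wrt (<) (b # dual_cascade b (c # cs))" using "3.prems" by (intro "3.IH") auto
  then show ?case using "3.prems" by (auto simp: sorted_wrt_append)
qed (auto simp: sorted_wrt_append)

lemma length_dual_cascade:
  "sorted_wrt (<) (p # bs) \<Longrightarrow> bs \<noteq> [] \<Longrightarrow>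
   length (dual_cascade p bs) + length bs + p = Suc (last bs)"
proof (induction p bs rule: dual_cascade.induct)
  case (3 p b c cs)
  have "length (dual_cascade b (c # cs)) + length (c # cs) + b = Suc (last (c # cs))"
    using "3.prems" by (intro "3.IH") auto
  moreover have "p < b" using "3.prems" by auto
  ultimately show ?case by (simp del: last.simps add: last_ConsR)
qed auto

text \<open>Pascal's rule telescopes from \<open>n - p\<close> down to \<open>n - b\<close>; each
  term \<open>(n - j) choose (v - 1)\<close> is reflected to the lower index that the run has at
  \<open>j\<close>.\<close>

lemma cascade_sum_upt:
  assumes "p \<le> b" "b + v \<le> n" "0 < v"
  shows "cascade_sum n (n - p - v) ([Suc p..<Suc b] @ xs) + ((n - b) choose v) =
    ((n - p) choose v) + cascade_sum n (n - b - v) xs"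
  using assms
proof (induction "b - p" arbitrary: p)
  case 0
  then show ?case by simp
next
  case (Suc d)
  then have p: "p < b" by simp
  obtain w where w: "v = Suc w" using Suc.prems by (cases v) auto
  have m: "n - p = Suc (n - Suc p)" using p Suc.prems by simp
  have "(n - Suc p) choose (n - p - v) = (n - Suc p) choose w"
    using binomial_symmetric[of w "n - Suc p"] p Suc.prems w by simp
  moreover have "cascade_sum n (n - Suc p - v) ([Suc (Suc p)..<Suc b] @ xs) + ((n - b) choose v) =
    ((n - Suc p) choose v) + cascade_sum n (n - b - v) xs"
    using Suc p by (intro Suc.hyps(1)) auto
  moreover have "[Suc p..<Suc b] = Suc p # [Suc (Suc p)..<Suc b]"
    using p by (simp add: upt_conv_Cons)
  moreover have "n - p - v - 1 = n - Suc p - v" by simp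
  moreover have "(n - p) choose v = ((n - Suc p) choose w) + ((n - Suc p) choose v)"
    unfolding m w by simp
  ultimately show ?case by (simp del: upt_Suc)
qed

text \<open>The run up to \<open>b - 1\<close> telescopes and leaves
  \<open>(n - b + 1) choose v\<close>. Pascal's rule splits this into the leading summand of
  \<open>bs\<close> and \<open>(n - b) choose (v - 1)\<close>, which induction divides between the
  two tails.\<close>

lemma cascade_sum_dual:
  "cascade_adm n p r bs \<Longrightarrow> bs \<noteq> [] \<Longrightarrow> v < r \<Longrightarrow> length bs \<le> v \<Longrightarrow>
   cascade_sum n (n - p - v) (dual_cascade p bs) + cascade_sum n v bs = (n - p) choose v"
proof (induction p bs arbitrary: r v rule: dual_cascade.induct)
  case (2 p b)
  then show ?case using cascade_sum_upt[of p b v n "[]"] by (simp del: upt_Suc)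
next
  case (3 p b c cs)
  obtain w where w: "v = Suc w" using "3.prems" by (cases v) auto
  have b: "p < b" "b + r \<le> n" "Suc (b - 1) = b" using "3.prems" by auto
  have n: "n - (b - 1) = Suc (n - b)" "n - (b - 1) - v = n - b - w"
    using b "3.prems" w by auto
  have "cascade_sum n (n - p - v) ([Suc p..<b] @ dual_cascade b (c # cs)) + ((n - (b - 1)) choose v) =
    ((n - p) choose v) + cascade_sum n (n - (b - 1) - v) (dual_cascade b (c # cs))"
    using cascade_sum_upt[of p "b - 1" v n "dual_cascade b (c # cs)"] b "3.prems" w by simp
  moreover have "cascade_sum n (n - b - w) (dual_cascade b (c # cs)) + cascade_sum n w (c # cs) = (n - b) choose w"
    using "3.prems" w by (intro "3.IH"[of "r - 1"]) auto
  ultimately show ?case unfolding n using w by simp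
qed simp

lemma sorted_list_of_set_set: "sorted_wrt (<) xs \<Longrightarrow> sorted_list_of_set (set xs) = (xs :: nat list)"
  by (simp add: sorted_list_of_set.idem_if_sorted_distinct strict_sorted_iff)

lemma cascade_good_altdef:
  "length bs \<le> r \<Longrightarrow>
   cascade_good n c r bs \<longleftrightarrow> (\<forall>i<length bs. n + c + 2 + 2 * i < bs ! i + 2 * r)"
proof (induction bs arbitrary: r)
  case (Cons b bs)
  then have "cascade_good n c (r - 1) bs \<longleftrightarrow> (\<forall>i<length bs. n + c + 2 + 2 * i < bs ! i + 2 * (r - 1))"
    by auto
  also have "\<dots> \<longleftrightarrow> (\<forall>i<length bs. n + c + 2 + 2 * Suc i < bs ! i + 2 * r)"
    using Cons.prems by (intro all_cong) auto
  finally show ?case by (simp add: All_less_Suc2)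
qed simp

section \<open>Resistant numbers\<close>

context
  fixes n k :: nat
  assumes nk: "2 * k < n" and k3: "3 \<le> k"
begin

section \<open>The size bound as a gain\<close>

lemma cascade_eqI: "is_cascade n k g bs \<Longrightarrow> cascade n k g = bs"
  unfolding cascade_def using nk
  by (intro the_equality) (auto simp: is_cascade_iff intro: cascade_sum_inj)

lemma cascade_gain_is_cascade:
  assumes "is_cascade n k g bs"
  shows "cascade_gain n (n - 2 * k) (n - k - 1) bs = int g - int (cascade_sum n (k - 1) (take k bs))"
proof -
  have "n - k - 1 - (n - 2 * k) = k - 1" "n - 2 * k \<le> n - k - 1" using nk k3 by auto
  moreover have "Suc (k - 1) = k" using k3 by simp
  ultimately show ?thesis
    using cascade_gain_eq[of n 1 "n - k - 1" bs "n - 2 * k"] assms nk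
    by (simp add: is_cascade_iff)
qed

text \<open>The sum over \<open>S\<^sub>\<gamma>\<close> is a dual cascade sum, hence
  \<open>(n - 1) choose (k - 1)\<close> minus the cascade sum with top index \<open>k - 1\<close>;
  adding \<open>g\<close> produces the gain. The cardinality bound counts
  \<open>{2..last bs}\<close> without the earlier entries and uses
  \<open>last bs \<le> k + length bs\<close>.\<close>

lemma size_bound_eq:
  assumes bs: "is_cascade n k g bs" and len: "length bs \<le> k - 1"
  shows "int (size_bound n k g) =
    int ((n - 1) choose (k - 1)) + cascade_gain n (n - 2 * k) (n - k - 1) bs"
    and "card (S_set n k g) \<le> k"
proof -
  have adm: "cascade_adm n 1 (n - k - 1) bs" and ne: "bs \<noteq> []"
    and sum: "cascade_sum n (n - k - 1) bs = g"
    using bs nk by (auto simp: is_cascade_iff)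
  have sorted: "sorted_wrt (<) (1 # bs)" using adm by (auto simp: cascade_adm_altdef)
  define D where "D = dual_cascade 1 bs"
  have sD: "sorted_wrt (<) D" using sorted_dual_cascade[OF sorted] by (simp add: D_def)
  have T: "T_set n k g = set bs" by (simp add: T_set_def cascade_eqI[OF bs])
  have "Max (set bs) = last bs"
    using ne sorted
  proof (intro Max_eqI)
    fix y
    assume "y \<in> set bs"
    then have "y \<in> set (butlast bs @ [last bs])" using ne by simp
    moreover have "sorted_wrt (<) (butlast bs @ [last bs])" using sorted ne by simp
    ultimately show "y \<le> last bs" by (auto simp: sorted_wrt_append)
  qed auto
  then have S: "S_set n k g = set D"
    unfolding S_set_def T D_def
    using set_dual_cascade[OF sorted ne] by (simp add: numeral_2_eq_2)
  have "last bs + (n - k - 1) \<le> n + (length bs - 1)"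
    using adm ne by (auto simp: cascade_adm_altdef last_conv_nth)
  then have lenD: "length D \<le> k"
    using length_dual_cascade[OF sorted ne] nk ne by (cases bs) (auto simp: D_def)
  have cardD: "card (set D) = length D"
    using sD by (simp add: strict_sorted_iff distinct_card)
  then show "card (S_set n k g) \<le> k" using lenD S by simp
  have sum_from_1: "(\<Sum>i=1..l. f i) = (\<Sum>i<l. f (Suc i))" for f :: "nat \<Rightarrow> nat" and l
    by (simp add: sum.atLeast1_atMost_eq)
  have "(\<Sum>i=1..card (S_set n k g). (n - kth (S_set n k g) i) choose (n - k - i + 1)) =
    (\<Sum>i<length D. (n - D ! i) choose (n - k - i))"
    unfolding S cardD kth_def sorted_list_of_set_set[OF sD] sum_from_1 using lenD nk
    by (intro sum.cong) (simp_all add: Suc_diff_Suc)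
  also have "\<dots> = cascade_sum n (n - 1 - (k - 1)) D"
    using k3 by (simp add: cascade_sum_altdef)
  finally have "size_bound n k g = cascade_sum n (n - 1 - (k - 1)) D + g"
    by (simp add: size_bound_def)
  moreover have "cascade_sum n (n - 1 - (k - 1)) D + cascade_sum n (k - 1) bs = (n - 1) choose (k - 1)"
    unfolding D_def using nk k3 by (intro cascade_sum_dual[OF adm ne _ len]) simp
  ultimately show "int (size_bound n k g) =
    int ((n - 1) choose (k - 1)) + cascade_gain n (n - 2 * k) (n - k - 1) bs"
    using cascade_gain_is_cascade[OF bs] len by simp
qed

text \<open>The list \<open>[4]\<close> just misses goodness, which demands
  \<open>b\<^sub>1 > 4\<close>; hence the top number is a case of its own.\<close>

lemma resistant_top:
  shows "is_cascade n k ((n - 4) choose (k - 3)) [4]"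
    and "(n - 4) choose (k - 3) = (n - 4) choose (n - k - 1)"
proof -
  show *: "(n - 4) choose (k - 3) = (n - 4) choose (n - k - 1)"
    using binomial_symmetric[of "k - 3" "n - 4"] nk k3 by simp
  show "is_cascade n k ((n - 4) choose (k - 3)) [4]"
    unfolding * using nk k3 by (subst is_cascade_iff) auto
qed

lemma resistant_top_less: "(n - 4) choose (k - 3) < (n - 1) choose (k - 1)"
proof -
  have "(n - 4) choose (k - 3) \<le> (n - 4) choose (k - 1)"
    using nk k3 by (intro binomial_le_of_sum_le) auto
  also have "\<dots> \<le> (n - 2) choose (k - 1)" by (intro binomial_right_mono) simp
  also have "\<dots> < ((n - 2) choose (k - 1)) + ((n - 2) choose (k - 2))"
    using nk k3 by (simp add: zero_less_binomial_iff)
  also have "\<dots> = (n - 1) choose (k - 1)"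
  proof -
    have "n - 1 = Suc (n - 2)" "k - 1 = Suc (k - 2)" using nk k3 by auto
    then show ?thesis by (simp only: binomial_Suc_Suc add.commute)
  qed
  finally show ?thesis .
qed

section \<open>Resistant numbers as good cascades\<close>

text \<open>Goodness gives \<open>b\<^sub>1 > 4\<close> and, for the last entry,
  \<open>2 * s + 2 < b\<^sub>s\<close>; admissibility gives \<open>b\<^sub>s \<le> k + s\<close>,
  whence \<open>s < k - 2\<close>.\<close>

lemma cascade_good_bounds:
  assumes "is_cascade n k g bs" "cascade_good n (n - 2 * k) (n - k - 1) bs"
  shows "cascade_adm n 4 (n - k - 1) bs" and "length bs \<le> k - 1"
proof -
  have adm: "cascade_adm n 1 (n - k - 1) bs" and ne: "bs \<noteq> []"
    using assms nk by (auto simp: is_cascade_iff)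
  show "cascade_adm n 4 (n - k - 1) bs"
    using adm ne assms(2) nk by (cases bs) auto
  define i where "i = length bs - 1"
  have i: "i < length bs" "length bs = Suc i" using ne by (auto simp: i_def)
  have "length bs \<le> n - k - 1" "bs ! i + (n - k - 1) \<le> n + i"
    using adm i by (auto simp: cascade_adm_altdef)
  moreover from this have "n + (n - 2 * k) + 2 + 2 * i < bs ! i + 2 * (n - k - 1)"
    using assms(2) i by (auto simp: cascade_good_altdef)
  ultimately show "length bs \<le> k - 1" using nk i by linarith
qed

text \<open>
  Condition (1) of resistance follows from (2), because an admissible cascade satisfies
  \<open>b\<^sub>i \<le> k + i\<close>.
\<close>

lemma resistant_iff:
  "resistant n k g \<longleftrightarrow> g = (n - 4) choose (k - 3) \<or>
     (\<exists>bs. is_cascade n k g bs \<and> cascade_good n (n - 2 * k) (n - k - 1) bs)"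
proof -
  have good: "cascade_good n (n - 2 * k) (n - k - 1) bs \<longleftrightarrow>
      (\<forall>i\<in>{1..card (T_set n k g)}. 2 * i + 2 < kth (T_set n k g) i)"
    and card: "card (T_set n k g) = length bs"
    if bs: "is_cascade n k g bs" for bs
  proof -
    have T: "T_set n k g = set bs" by (simp add: T_set_def cascade_eqI[OF bs])
    have sorted: "sorted_wrt (<) bs" and len: "length bs \<le> n - k - 1"
      using bs by (auto simp: is_cascade_def)
    show card: "card (T_set n k g) = length bs"
      unfolding T using sorted by (simp add: strict_sorted_iff distinct_card)
    have *: "(\<forall>i\<in>{1..m}. Q i) \<longleftrightarrow> (\<forall>i<m. Q (Suc i))" for Q and m :: nat
    proof -
      have "{1..m} = Suc ` {..<m}" by (simp add: image_Suc_lessThan)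
      then show ?thesis by auto
    qed
    have "n + (n - 2 * k) + 2 + 2 * i < x + 2 * (n - k - 1) \<longleftrightarrow> 2 * Suc i + 2 < x" for i x
      using nk by auto
    then show "cascade_good n (n - 2 * k) (n - k - 1) bs \<longleftrightarrow>
      (\<forall>i\<in>{1..card (T_set n k g)}. 2 * i + 2 < kth (T_set n k g) i)"
      unfolding cascade_good_altdef[OF len] card * unfolding kth_def T sorted_list_of_set_set[OF sorted]
      by simp
  qed
  have "g < (n - 1) choose (k - 1) \<and> 0 < g \<and> card (S_set n k g) \<le> k \<and> card (T_set n k g) \<le> k - 1"
    if bs: "is_cascade n k g bs" and bs_good: "cascade_good n (n - 2 * k) (n - k - 1) bs" for bs
  proof -
    note adm = cascade_good_bounds[OF bs bs_good]
    have "g = cascade_sum n (n - k - 1) bs" "bs \<noteq> []" using bs nk by (auto simp: is_cascade_iff)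
    then have "0 < g" "g < (n - 4) choose (n - k - 1)"
      using cascade_sum_pos[OF adm(1)] cascade_sum_less[OF adm(1)] nk k3 by auto
    then show ?thesis
      using resistant_top_less resistant_top(2) size_bound_eq(2)[OF bs adm(2)] card[OF bs] adm(2) by linarith
  qed
  note bounds = this
  show ?thesis
  proof
    assume g: "resistant n k g"
    show "g = (n - 4) choose (k - 3) \<or>
      (\<exists>bs. is_cascade n k g bs \<and> cascade_good n (n - 2 * k) (n - k - 1) bs)"
    proof (cases "g = (n - 4) choose (k - 3)")
      case False
      then have "0 < g" "g < (n - 1) choose (k - 1)"
        and kth: "\<forall>i\<in>{1..card (T_set n k g)}. 2 * i + 2 < kth (T_set n k g) i"
        using g unfolding resistant_def by blast+
      then obtain bs where bs: "is_cascade n k g bs" using is_cascade_ex1[OF nk] by blast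
      then show ?thesis using good[OF bs] kth by blast
    qed simp
  next
    assume "g = (n - 4) choose (k - 3) \<or>
      (\<exists>bs. is_cascade n k g bs \<and> cascade_good n (n - 2 * k) (n - k - 1) bs)"
    then show "resistant n k g"
    proof (elim disjE exE conjE)
      fix bs
      assume bs: "is_cascade n k g bs" "cascade_good n (n - 2 * k) (n - k - 1) bs"
      show ?thesis using bounds[OF bs] bs(2)[unfolded good[OF bs(1)]] unfolding resistant_def by blast
    qed (simp add: resistant_def)
  qed
qed

lemma resistant_cases:
  assumes "resistant n k g"
  obtains bs where "is_cascade n k g bs" "length bs \<le> k - 1"
      "cascade_good n (n - 2 * k) (n - k - 1) bs" "cascade_adm n 4 (n - k - 1) bs"
      "g < (n - 4) choose (k - 3)"
  | "g = (n - 4) choose (k - 3)"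
proof (cases "g = (n - 4) choose (k - 3)")
  case False
  then obtain bs where bs: "is_cascade n k g bs" "cascade_good n (n - 2 * k) (n - k - 1) bs"
    using assms resistant_iff by blast
  note adm = cascade_good_bounds[OF bs]
  have "g = cascade_sum n (n - k - 1) bs" using bs nk by (auto simp: is_cascade_iff)
  then have "g < (n - 4) choose (k - 3)"
    unfolding resistant_top(2) using cascade_sum_less[OF adm(1)] nk k3 by auto
  then show ?thesis using that(1)[OF bs(1) adm(2) bs(2) adm(1)] by simp
qed (use that in blast)

lemma size_bound_top:
  "int (size_bound n k ((n - 4) choose (k - 3))) =
    int ((n - 1) choose (k - 1)) + block_gain n (n - 2 * k) 4 (n - k - 1)"
  using size_bound_eq(1)[OF resistant_top(1)] k3 by simp

lemma size_bound_strict_antimono: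
  assumes "resistant n k g" "resistant n k h" "g < h"
  shows "size_bound n k h < size_bound n k g"
proof (cases rule: resistant_cases[OF assms(1)])
  case (1 bs)
  note bs = this
  show ?thesis
  proof (cases rule: resistant_cases[OF assms(2)])
    case (1 cs)
    have "cascade_gain n (n - 2 * k) (n - k - 1) cs < cascade_gain n (n - 2 * k) (n - k - 1) bs"
      using bs 1 assms(3) nk by (intro cascade_gain_strict_antimono[of n 4]) (auto simp: is_cascade_iff)
    then show ?thesis using size_bound_eq(1)[OF bs(1,2)] size_bound_eq(1)[OF 1(1,2)] by linarith
  next
    case 2
    \<comment> \<open>Every good cascade lies inside the block at 4, and that whole block is the top
      number.\<close>
    have "block_gain n (n - 2 * k) 4 (n - k - 1) < cascade_gain n (n - 2 * k) (n - k - 1) bs"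
      using bs nk k3 by (intro block_gain_less_cascade_gain) auto
    then show ?thesis using size_bound_eq(1)[OF bs(1,2)] size_bound_top unfolding 2 by linarith
  qed
next
  case 2
  show ?thesis by (cases rule: resistant_cases[OF assms(2)]) (use 2 assms(3) in simp_all)
qed

section \<open>The upper bound and its sharpness\<close>

lemma intersecting_card_le:
  assumes F: "F \<subseteq> k_subsets n k" "intersecting F"
    and bs: "is_cascade n k (diversity n F) bs"
  shows "int (card F) \<le> int ((n - 1) choose (k - 1)) + cascade_gain n (n - 2 * k) (n - k - 1) bs"
proof -
  have "max_degree n F \<in> degree F ` {1..n}"
    unfolding max_degree_def using nk by (intro Max_in) auto
  then obtain x where x: "x \<in> {1..n}" "max_degree n F = degree F x" by auto
  define X where "X = {1..n} - {x}"
  have X: "finite X" "card X = n - 1" using x by (auto simp: X_def)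
  define A where "A = (\<lambda>S. S - {x}) ` {S \<in> F. x \<in> S}"
  define B where "B = {S \<in> F. x \<notin> S}"
  have F_sub: "S \<subseteq> {1..n}" "card S = k" if "S \<in> F" for S
    using that F by (auto simp: k_subsets_def)
  have finF: "finite F" using F_sub(1) finite_subset[of F "Pow {1..n}"] by auto
  have "inj_on (\<lambda>S. S - {x}) {S \<in> F. x \<in> S}" by (rule inj_onI) auto
  then have cardA: "card A = degree F x" unfolding A_def degree_def by (rule card_image)
  have "card F = card ({S \<in> F. x \<in> S} \<union> B)"
    by (rule arg_cong[of _ _ card]) (auto simp: B_def)
  also have "\<dots> = degree F x + card B"
    unfolding degree_def using finF by (intro card_Un_disjoint) (auto simp: B_def)
  finally have cardF: "card F = card A + card B" using cardA by simp
  have div: "diversity n F = card B" unfolding diversity_def x(2) using cardF cardA by simp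
  have A_sub: "A \<subseteq> {S. S \<subseteq> X \<and> card S = k - 1}"
    using F_sub by (auto simp: A_def X_def card_Diff_singleton)
  have B_sub: "B \<subseteq> {S. S \<subseteq> X \<and> card S = k}"
    using F_sub by (auto simp: B_def X_def)
  have cross: "S \<inter> T \<noteq> {}" if "S \<in> A" "T \<in> B" for S T
  proof -
    obtain S' where "S' \<in> F" "S = S' - {x}" using \<open>S \<in> A\<close> by (auto simp: A_def)
    moreover have "T \<in> F" "x \<notin> T" using \<open>T \<in> B\<close> by (auto simp: B_def)
    ultimately show ?thesis using F(2) unfolding intersecting_def by blast
  qed
  have r: "n - 1 - k = n - k - 1" "Suc (k - 1) = k" using k3 by auto
  have "card A + cascade_sum n (k - 1) (take (Suc (k - 1)) bs) \<le> (n - 1) choose (k - 1)"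
  proof (rule cross_intersecting_card_le[OF X A_sub B_sub cross])
    show "cascade_adm n 1 (n - 1 - k) bs" "cascade_sum n (n - 1 - k) bs = card B"
      using bs nk div unfolding r by (auto simp: is_cascade_iff)
    show "k - 1 + k \<le> n - 1" using nk by linarith
  qed
  then show ?thesis using cascade_gain_is_cascade[OF bs] div cardF r by simp
qed

text \<open>Below the top number the cascade starts beyond 4, as an entry at most 4 already
  contributes the top number. So \<open>cascade_gain_le_good\<close> applies to the block at 4, and
  its two outcomes are a good cascade and the top number itself.\<close>

lemma gain_le_resistant:
  assumes bs: "is_cascade n k d bs" and d: "d \<le> (n - 4) choose (k - 3)"
  shows "\<exists>g. resistant n k g \<and> d \<le> g \<and>
    int ((n - 1) choose (k - 1)) + cascade_gain n (n - 2 * k) (n - k - 1) bs \<le> int (size_bound n k g)"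
proof (cases "d = (n - 4) choose (k - 3)")
  case True
  then have "bs = [4]" using cascade_eqI[OF bs] cascade_eqI[OF resistant_top(1)] by simp
  then show ?thesis
    using True size_bound_top by (intro exI[of _ d]) (simp add: resistant_def)
next
  case False
  have adm: "cascade_adm n 1 (n - k - 1) bs" and ne: "bs \<noteq> []"
    and sum: "cascade_sum n (n - k - 1) bs = d"
    using bs nk by (auto simp: is_cascade_iff)
  obtain b bs' where Cons: "bs = b # bs'" using ne by (cases bs) auto
  have "4 < b"
  proof (rule ccontr)
    assume "\<not> 4 < b"
    then have "(n - 4) choose (n - k - 1) \<le> (n - b) choose (n - k - 1)"
      by (intro binomial_right_mono) simp
    then show False using sum Cons d False resistant_top(2) by simp
  qed
  then have adm4: "cascade_adm n 4 (n - k - 1) bs" using adm Cons by auto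
  have "0 < d" using cascade_sum_pos[OF adm ne] sum by simp
  consider cs where "cascade_adm n 4 (n - k - 1) cs" "cascade_good n (n - 2 * k) (n - k - 1) cs"
      "d \<le> cascade_sum n (n - k - 1) cs"
      "cascade_gain n (n - 2 * k) (n - k - 1) bs \<le> cascade_gain n (n - 2 * k) (n - k - 1) cs"
    | "cascade_gain n (n - 2 * k) (n - k - 1) bs \<le> block_gain n (n - 2 * k) 4 (n - k - 1)"
  proof -
    have "4 + (n - k - 1) \<le> n" "n + (n - 2 * k) < 4 + 2 * (n - k - 1)" using nk k3 by auto
    from cascade_gain_le_good[OF adm4 this] show ?thesis using that unfolding sum by blast
  qed
  then show ?thesis
  proof cases
    case 1
    define g where "g = cascade_sum n (n - k - 1) cs"
    have "cs \<noteq> []" using 1(3) \<open>0 < d\<close> by auto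
    then have cs: "is_cascade n k g cs"
      using 1(1) nk cascade_adm_mono[of n 4 "n - k - 1" cs 1] by (auto simp: is_cascade_iff g_def)
    then have "resistant n k g" using 1(2) resistant_iff by blast
    then show ?thesis
      using 1 size_bound_eq(1)[OF cs cascade_good_bounds(2)[OF cs 1(2)]] by (intro exI[of _ g]) (simp add: g_def)
  next
    case 2
    then show ?thesis
      using size_bound_top d by (intro exI[of _ "(n - 4) choose (k - 3)"]) (simp add: resistant_def)
  qed
qed

lemma resistant_attained:
  assumes "resistant n k g"
  shows "\<exists>F. F \<subseteq> k_subsets n k \<and> intersecting F \<and> diversity n F = g \<and> card F = size_bound n k g"
proof -
  \<comment> \<open>Starting beyond 3 covers both good cascades and \<open>[4]\<close>; the lower
    bound on the gain will make 1 an element of maximal degree.\<close>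
  obtain bs where bs: "is_cascade n k g bs" and len: "length bs \<le> k - 1"
    and adm3: "cascade_adm n 3 (n - k - 1) bs"
    and gain: "block_gain n (n - 2 * k) 4 (n - k - 1) \<le> cascade_gain n (n - 2 * k) (n - k - 1) bs"
    and g: "g \<le> (n - 4) choose (k - 3)"
  proof (cases rule: resistant_cases[OF assms])
    case (1 bs)
    moreover have "block_gain n (n - 2 * k) 4 (n - k - 1) < cascade_gain n (n - 2 * k) (n - k - 1) bs"
      using 1 nk k3 by (intro block_gain_less_cascade_gain) auto
    ultimately show ?thesis
      using that[of bs] cascade_adm_mono[of n 4 "n - k - 1" bs 3] by simp
  next
    case 2
    then show ?thesis using that[of "[4]"] resistant_top(1) nk k3 by simp
  qed
  have adm: "cascade_adm n 1 (n - k - 1) bs" and sum: "cascade_sum n (n - k - 1) bs = g"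
    using bs nk by (auto simp: is_cascade_iff)
  have r: "n - 1 - (n - k - 1) = k" using nk by simp
  \<comment> \<open>The element 1 is set aside. Since the cascade starts beyond 2, every member of
    \<open>B\<close> contains 2, so \<open>B\<close> is intersecting.\<close>
  obtain A B where A: "A \<subseteq> {S. S \<subseteq> {2..n} \<and> card S = k - 1}"
    and B: "B \<subseteq> {S. S \<subseteq> {2..n} \<and> card S = k}"
    and cross: "\<forall>S\<in>A. \<forall>T\<in>B. S \<inter> T \<noteq> {}"
    and cardB: "card B = g" and cardA: "card A + cascade_sum n (k - 1) bs = (n - 1) choose (k - 1)"
    and two: "\<forall>T\<in>B. 2 \<in> T"
    using exists_cross_intersecting[OF adm len] cascade_adm_mono[OF adm3, of 2]
    unfolding r sum by (auto simp: numeral_2_eq_2)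
  define F where "F = insert 1 ` A \<union> B"
  have finA: "finite A" and finB: "finite B"
    using finite_uniform[OF _ A] finite_uniform[OF _ B] by auto
  have A': "insert 1 ` A \<subseteq> {S. S \<subseteq> {1..n} \<and> card S = k}" "card (insert 1 ` A) = card A"
    using insert_uniform[of A 1 n "k - 1"] A nk k3 by (auto simp: numeral_2_eq_2)
  have B1: "1 \<notin> T" if "T \<in> B" for T using subsetD[OF B that] by auto
  have "insert 1 ` A \<inter> B = {}" using B1 by blast
  then have cardF: "card F = card A + card B"
    unfolding F_def using finA finB A'(2) by (simp add: card_Un_disjoint)
  have "B \<subseteq> k_subsets n k"
    unfolding k_subsets_def by (rule order.trans[OF B]) fastforce
  then have F_sub: "F \<subseteq> k_subsets n k"
    using A'(1) unfolding F_def k_subsets_def by blast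
  have F_int: "intersecting F"
    unfolding intersecting_def F_def using cross two by blast
  have gain_eq: "cascade_gain n (n - 2 * k) (n - k - 1) bs = int g - int (cascade_sum n (k - 1) bs)"
    using cascade_gain_is_cascade[OF bs] len by simp
  have deg1: "degree F 1 = card A"
  proof -
    have "{S \<in> F. 1 \<in> S} = insert 1 ` A" using B1 by (auto simp: F_def)
    then show ?thesis using A'(2) by (simp add: degree_def)
  qed
  \<comment> \<open>At most \<open>(n - 2) choose (k - 2)\<close> members contain 1 and a given
    other element, so this inequality bounds every other degree by that of 1. It follows from the
    gain of the block at 4 by expanding \<open>(n - 1) choose (k - 1)\<close> with Pascal's
    rule.\<close>
  have big: "((n - 2) choose (k - 2)) + card B \<le> card A"
  proof -
    obtain j where j: "k = Suc (Suc (Suc j))" using k3 by (metis numeral_3_eq_3 le_Suc_ex add_Suc)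
    define m where "m = n - 4"
    have m: "n - 1 = Suc (Suc (Suc m))" "n - 2 = Suc (Suc m)" using nk k3 by (auto simp: m_def)
    have "int (card A) = int ((n - 1) choose (k - 1)) + cascade_gain n (n - 2 * k) (n - k - 1) bs - int g"
      using cardA gain_eq by linarith
    moreover have "block_gain n (n - 2 * k) 4 (n - k - 1) =
      int ((n - 4) choose (k - 3)) - int ((n - 4) choose (k - 1))"
    proof -
      have "int (n - k - 1) - int (n - 2 * k) = int (k - 1)" using nk k3 by simp
      then show ?thesis unfolding block_gain_def resistant_top(2) by simp
    qed
    ultimately have "(n - 1) choose (k - 1) \<le> card A + ((n - 4) choose (k - 1))"
      using gain g by linarith
    moreover have "(n - 1) choose (k - 1) \<ge>
      ((n - 2) choose (k - 2)) + ((n - 4) choose (k - 1)) + ((n - 4) choose (k - 3))"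
      unfolding m using j by (simp flip: m_def)
    ultimately show ?thesis using g cardB by linarith
  qed
  have "degree F y \<le> degree F 1" if y: "y \<in> {1..n}" for y
  proof (cases "y = 1")
    case False
    then have y2: "y \<in> {2..n}" using y by auto
    define C where "C = (\<lambda>S. S - {y}) ` {S \<in> A. y \<in> S}"
    have "inj_on (\<lambda>S. S - {y}) {S \<in> A. y \<in> S}" by (rule inj_onI) auto
    then have "card {S \<in> A. y \<in> S} = card C" unfolding C_def by (rule card_image[symmetric])
    also have "\<dots> \<le> card {S. S \<subseteq> {2..n} - {y} \<and> card S = k - 2}"
      using A by (intro card_mono) (auto simp: C_def card_Diff_singleton)
    also have "\<dots> = (n - 2) choose (k - 2)"
      using y2 by (simp add: n_subsets numeral_2_eq_2)
    finally have C: "card {S \<in> A. y \<in> S} \<le> (n - 2) choose (k - 2)" .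
    have "{S \<in> F. y \<in> S} \<subseteq> insert 1 ` {S \<in> A. y \<in> S} \<union> B"
      using False by (auto simp: F_def)
    then have "degree F y \<le> card (insert 1 ` {S \<in> A. y \<in> S} \<union> B)"
      unfolding degree_def using finA finB by (intro card_mono) auto
    also have "\<dots> \<le> card (insert 1 ` {S \<in> A. y \<in> S}) + card B" by (rule card_Un_le)
    also have "\<dots> \<le> card {S \<in> A. y \<in> S} + card B"
      using finA by (intro add_right_mono card_image_le) auto
    finally show ?thesis using C big deg1 by linarith
  qed simp
  then have "max_degree n F = card A"
    unfolding max_degree_def deg1[symmetric] using nk by (intro Max_eqI) auto
  then have "diversity n F = g" by (simp add: diversity_def cardF cardB)
  moreover have "card F = size_bound n k g"
    using size_bound_eq(1)[OF bs len] gain_eq cardA cardF cardB by linarith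
  ultimately show ?thesis using F_sub F_int by blast
qed

end

theorem theorem16:
  fixes n k m :: nat and \<gamma> :: "nat \<Rightarrow> nat"
  assumes "2 * k < n" and "6 \<le> 2 * k"
    and "strict_mono_on {0..m} \<gamma>"
    and "\<gamma> ` {0..m} = insert 0 {g. resistant n k g}"
    and "\<gamma> 0 = 0" and "\<gamma> m = (n - 4) choose (k - 3)"
  shows "(\<forall>l\<in>{1..m}. \<forall>F. F \<subseteq> k_subsets n k \<and> intersecting F \<and>
            \<gamma> (l - 1) < diversity n F \<and> diversity n F \<le> \<gamma> l \<longrightarrow>
            card F \<le> size_bound n k (\<gamma> l)) \<and>
         (\<forall>l\<in>{1..m}. \<forall>l'\<in>{1..m}. l < l' \<longrightarrow> size_bound n k (\<gamma> l') < size_bound n k (\<gamma> l)) \<and>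
         (\<forall>l\<in>{1..m}. \<exists>F. F \<subseteq> k_subsets n k \<and> intersecting F \<and>
            diversity n F = \<gamma> l \<and> card F = size_bound n k (\<gamma> l))"
proof -
  have k3: "3 \<le> k" using assms(2) by simp
  have less: "\<gamma> i < \<gamma> j" if "i < j" "j \<le> m" for i j
    using strict_mono_onD[OF assms(3), of i j] that by simp
  have res: "resistant n k (\<gamma> l)" if "l \<in> {1..m}" for l
  proof -
    have "\<gamma> l \<in> \<gamma> ` {0..m}" using that by auto
    moreover have "\<gamma> 0 < \<gamma> l" using that by (intro less) auto
    ultimately show ?thesis using assms(4,5) by auto
  qed
  have dec: "size_bound n k (\<gamma> l') < size_bound n k (\<gamma> l)"
    if "l \<in> {1..m}" "l' \<in> {1..m}" "l < l'" for l l'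
    using that res less by (intro size_bound_strict_antimono[OF assms(1) k3]) auto
  have "card F \<le> size_bound n k (\<gamma> l)"
    if l: "l \<in> {1..m}" and F: "F \<subseteq> k_subsets n k" "intersecting F"
      and d: "\<gamma> (l - 1) < diversity n F" "diversity n F \<le> \<gamma> l" for l F
  proof -
    have "\<gamma> l \<le> \<gamma> m" using less[of l m] l by (cases "l = m") auto
    then have top: "diversity n F \<le> (n - 4) choose (k - 3)" using d assms(6) by simp
    then have "0 < diversity n F" "diversity n F < (n - 1) choose (k - 1)"
      using d resistant_top_less[OF assms(1) k3] by auto
    then obtain bs where bs: "is_cascade n k (diversity n F) bs"
      using is_cascade_ex1[OF assms(1)] by blast
    \<comment> \<open>This resistant number may lie beyond \<open>\<gamma> l\<close>; monotonicity
      of the size bound then transfers the estimate to \<open>\<gamma> l\<close>.\<close>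
    obtain g where g: "resistant n k g" "diversity n F \<le> g"
      "int ((n - 1) choose (k - 1)) + cascade_gain n (n - 2 * k) (n - k - 1) bs \<le> int (size_bound n k g)"
      using gain_le_resistant[OF assms(1) k3 bs top] by blast
    have "card F \<le> size_bound n k g"
      using intersecting_card_le[OF assms(1) k3 F bs] g(3) by linarith
    also have "g \<in> \<gamma> ` {0..m}" using g(1) assms(4) by simp
    then obtain j where j: "j \<le> m" "g = \<gamma> j" by auto
    \<comment> \<open>Otherwise \<open>g \<le> \<gamma> (l - 1)\<close>, which is below the
      diversity and hence below \<open>g\<close>.\<close>
    have "\<not> j < l"
    proof
      assume "j < l"
      then have "j = l - 1 \<or> j < l - 1" by linarith
      then have "\<gamma> j \<le> \<gamma> (l - 1)" using less[of j "l - 1"] l by fastforce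
      then show False using d g(2) j by simp
    qed
    then have "size_bound n k g \<le> size_bound n k (\<gamma> l)"
      using dec[of l j] l j by (cases "j = l") auto
    finally show ?thesis .
  qed
  note bound = this
  show ?thesis
  proof (intro conjI ballI allI impI)
    show "card F \<le> size_bound n k (\<gamma> l)"
      if "l \<in> {1..m}" "F \<subseteq> k_subsets n k \<and> intersecting F \<and>
        \<gamma> (l - 1) < diversity n F \<and> diversity n F \<le> \<gamma> l" for l F
      using that by (intro bound) simp_all
  qed (use dec resistant_attained[OF assms(1) k3 res] in \<open>simp_all\<close>)
qed

end
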